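(* Let $k>t\geq 2$ be integers. The class $\mathcal K$ of all finite structures $\mathbf A=(A,\leq_{\mathbf A},F_{\mathbf A})$ satisfying the conditions (1)-(4) listed in the context, with the embeddings defined there, is a Ramsey class. Consequently, the class $\vec{\mathcal S}_{k,t}$ of all finite linearly ordered partial $(k,t)$-Steiner systems with strong embeddings is a Ramsey class.
   Context: For a set $A$, $\binom{A}{k}$ denotes the set of all $k$-element subsets of $A$. The class $\mathcal K$ consists of the finite structures $\mathbf A=(A,\leq_{\mathbf A},F_{\mathbf A})$ where: (1) $A$ is a set linearly ordered by $\leq_{\mathbf A}$; (2) $F_{\mathbf A}$ is a partial function from $A^t$ to $\binom{A}{k}$, with domain $\mathrm{Dom}(F_{\mathbf A})\subseteq A^t$; (3) every $\vec t\in\mathrm{Dom}(F_{\mathbf A})$ has no repeated vertices; (4) for every $\vec t\in\mathrm{Dom}(F_{\mathbf A})$, every vertex of $\vec t$ belongs to $F_{\mathbf A}(\vec t)$, and every $t$-tuple $\vec t_2$ of distinct vertices of $F_{\mathbf A}(\vec t)$ is in $\mathrm{Dom}(F_{\mathbf A})$ and satisfies $F_{\mathbf A}(\vec t_2)=F_{\mathbf A}(\vec t)$. Embeddings in $\mathcal K$: a map $f:A\to B$ is an embedding $\mathbf A\to\mathbf B$ if it is a monotone (order-preserving) injection such that, for all $x_1,\dots,x_t\in A$, $(x_1,\dots,x_t)\in\mathrm{Dom}(F_{\mathbf A})$ if and only if $(f(x_1),\dots,f(x_t))\in\mathrm{Dom}(F_{\mathbf B})$, and in that case $F_{\mathbf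 B}(f(x_1),\dots,f(x_t))=f(F_{\mathbf A}(x_1,\dots,x_t))$ (image of a set). Partial $(k,t)$-Steiner system: a $k$-uniform hypergraph $G=(V,E)$ such that every $t$-element subset of $V$ is contained in at most one edge $e\in E$. It is linearly ordered if $V$ carries a linear order. Strong embedding: for linearly ordered partial $(k,t)$-Steiner systems $G=(V,E)$ and $G'=(V',E')$, a monotone injective map $h:V\to V'$ is a strong embedding if it is an embedding of hypergraphs (for every $e\in\binom{V}{k}$, $e\in E$ if and only if $h(e)\in E'$) and moreover no $t$-element subset of $h(V)$ is contained in an edge of $G'$ that is not of the form $h(e)$ with $e\in E$. Copies: a copy of $\mathbf A$ in $\mathbf B$ is the image $f(\mathbf A)$ of an embedding $f:\mathbf A\to\mathbf B$ (the set $f(A)$ with the structure transported from $\mathbf A$ by $f$). $\binom{\mathbf B}{\mathbf A}$ denotes the set of all copies of $\mathbf A$ in $\mathbf B$. For Steiner systems "embedding" here means strong embedding. Ramsey class: a class $\mathcal C$ of structures with embeddings is a Ramsey class if for all $\mathbf A,\mathbf B\in\mathcal C$ and every positive integer $r$ there exists $\mathbf C\in\mathcal C$ such that for every partition of $\binom{\mathbf C}{\mathbf A}$ into $r$ classes there is $\widetilde{\mathbf B}\in\binom{\mathbf C}{\mathbf B}$ such that $\binom{\widetilde{\mathbf B}}{\mathbf A}$ is contained in one class of the partition. *)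

theory Defs
  imports "HOL-Library.Ramsey" "HOL-Library.Disjoint_Sets"
begin

text \<open>Throughout, \<open>[A]\<^bsup>k\<^esup>\<close> (library constant \<^const>\<open>nsets\<close>) is the set of \<open>k\<close>-element
  subsets of \<open>A\<close>. Structures have their vertices in an arbitrary type \<open>'v\<close>; orders and
  partial functions carry no data outside the vertex set, so that equality of
  structures is the intended one.\<close>

record 'v lin_set =
  verts :: "'v set"
  ord :: "'v rel"

record 'v func_struct = "'v lin_set" +
  func :: "'v list \<Rightarrow> 'v set option"

record 'v ord_hypergraph = "'v lin_set" +
  edges :: "'v set set"

text \<open>\<open>emb f A B\<close> means that \<open>f\<close> is an embedding of \<open>A\<close> into \<open>B\<close>, and \<open>img f A\<close> is the
  structure transported from \<open>A\<close> along \<open>f\<close>.\<close>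

definition copies ::
  "('f \<Rightarrow> 's \<Rightarrow> 's \<Rightarrow> bool) \<Rightarrow> ('f \<Rightarrow> 's \<Rightarrow> 's) \<Rightarrow> 's \<Rightarrow> 's \<Rightarrow> 's set" where
  "copies emb img B A = {img f A | f. emb f A B}"

text \<open>A partition into \<open>r\<close> classes is an indexed family \<open>P 0, \<dots>, P (r - 1)\<close> of pairwise
  disjoint, possibly empty sets.\<close>

definition ramsey_class ::
  "'s set \<Rightarrow> ('f \<Rightarrow> 's \<Rightarrow> 's \<Rightarrow> bool) \<Rightarrow> ('f \<Rightarrow> 's \<Rightarrow> 's) \<Rightarrow> bool" where
  "ramsey_class \<C> emb img \<longleftrightarrow>
     (\<forall>A\<in>\<C>. \<forall>B\<in>\<C>. \<forall>r::nat. r > 0 \<longrightarrow>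
       (\<exists>C\<in>\<C>. \<forall>P :: nat \<Rightarrow> 's set.
          disjoint_family_on P {..<r} \<and> (\<Union>i<r. P i) = copies emb img C A \<longrightarrow>
          (\<exists>B'\<in>copies emb img C B. \<exists>i<r. copies emb img B' A \<subseteq> P i)))"

definition mono_inj ::
  "('v \<Rightarrow> 'v) \<Rightarrow> ('v, 'a) lin_set_scheme \<Rightarrow> ('v, 'b) lin_set_scheme \<Rightarrow> bool" where
  "mono_inj f A B \<longleftrightarrow>
     f \<in> verts A \<rightarrow> verts B \<and> inj_on f (verts A) \<and>
     monotone_on (verts A) (\<lambda>x y. (x, y) \<in> ord A) (\<lambda>x y. (x, y) \<in> ord B) f"

definition class_K :: "nat \<Rightarrow> nat \<Rightarrow> 'v func_struct set" where
  "class_K k t = {A.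
     finite (verts A) \<and>
     linear_order_on (verts A) (ord A) \<and>
     dom (func A) \<subseteq> {ts. length ts = t \<and> set ts \<subseteq> verts A} \<and>
     ran (func A) \<subseteq> [verts A]\<^bsup>k\<^esup> \<and>
     (\<forall>ts\<in>dom (func A). distinct ts) \<and>
     (\<forall>ts\<in>dom (func A).
        set ts \<subseteq> the (func A ts) \<and>
        (\<forall>ts2. length ts2 = t \<and> distinct ts2 \<and> set ts2 \<subseteq> the (func A ts) \<longrightarrow>
           ts2 \<in> dom (func A) \<and> the (func A ts2) = the (func A ts)))}"

definition K_embedding ::
  "nat \<Rightarrow> ('v \<Rightarrow> 'v) \<Rightarrow> 'v func_struct \<Rightarrow> 'v func_struct \<Rightarrow> bool" where
  "K_embedding t f A B \<longleftrightarrow>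
     mono_inj f A B \<and>
     (\<forall>xs. length xs = t \<and> set xs \<subseteq> verts A \<longrightarrow>
        (xs \<in> dom (func A) \<longleftrightarrow> map f xs \<in> dom (func B)) \<and>
        (xs \<in> dom (func A) \<longrightarrow> the (func B (map f xs)) = f ` the (func A xs)))"

text \<open>Used only for \<open>f\<close> injective on the vertices of \<open>A\<close>: then \<open>map f xs\<close> is sent to
  \<open>f ` F xs\<close>, where \<open>F\<close> is the partial function of \<open>A\<close>.\<close>

definition K_image :: "('v \<Rightarrow> 'v) \<Rightarrow> 'v func_struct \<Rightarrow> 'v func_struct" where
  "K_image f A =
     \<lparr>verts = f ` verts A,
      ord = map_prod f f ` ord A,
      func = (\<lambda>ys. if set ys \<subseteq> f ` verts A
                   then map_option ((`) f) (func A (map (inv_into (verts A) f) ys))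
                   else None)\<rparr>"

definition steiner_systems :: "nat \<Rightarrow> nat \<Rightarrow> 'v ord_hypergraph set" where
  "steiner_systems k t = {G.
     finite (verts G) \<and>
     linear_order_on (verts G) (ord G) \<and>
     edges G \<subseteq> [verts G]\<^bsup>k\<^esup> \<and>
     (\<forall>s\<in>[verts G]\<^bsup>t\<^esup>. \<forall>e\<in>edges G. \<forall>e'\<in>edges G. s \<subseteq> e \<and> s \<subseteq> e' \<longrightarrow> e = e')}"

definition strong_embedding ::
  "nat \<Rightarrow> nat \<Rightarrow> ('v \<Rightarrow> 'v) \<Rightarrow> 'v ord_hypergraph \<Rightarrow> 'v ord_hypergraph \<Rightarrow> bool" where
  "strong_embedding k t h G G' \<longleftrightarrow>
     mono_inj h G G' \<and>
     (\<forall>e\<in>[verts G]\<^bsup>k\<^esup>. e \<in> edges G \<longleftrightarrow> h ` e \<in> edges G') \<and>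
     (\<forall>s\<in>[h ` verts G]\<^bsup>t\<^esup>. \<forall>e'\<in>edges G'. s \<subseteq> e' \<longrightarrow> (\<exists>e\<in>edges G. e' = h ` e))"

definition steiner_image :: "('v \<Rightarrow> 'v) \<Rightarrow> 'v ord_hypergraph \<Rightarrow> 'v ord_hypergraph" where
  "steiner_image h G =
     \<lparr>verts = h ` verts G,
      ord = map_prod h h ` ord G,
      edges = (`) h ` edges G\<rparr>"

end

theory Submission
  imports Defs "HOL-Library.Countable"
begin

text \<open>A structure in \<open>\<K>\<close> is the same as an ordered partial Steiner system, since \<open>F\<close> sends a tuple to
  the unique edge containing it; so only Steiner systems matter. Call two copies \<open>p\<close>, \<open>q\<close> of a system
  compatible if every edge of one that has at least \<open>t\<close> vertices in the other is an edge of the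
  other. A union of pairwise compatible copies is again a Steiner system in which each of the copies is
  strongly embedded. This is the only invariant maintained, and it turns the partite construction
  (amalgamation along the lines given by the Hales--Jewett theorem) into one that stays inside the
  class, provided that the base is clean: the copies of \<open>B\<close> and of \<open>A\<close> that the construction projects
  to are compatible, while the base itself need not be a Steiner system.

  Over a plain Ramsey number \<open>N \<longrightarrow> (b)\<^sup>a\<close> cleanness fails. But the copies of a system \<open>P\<close>
  amalgamated along Hales--Jewett lines do form a clean base, because a line and a word agree on an
  intersection of strong copies of \<open>A\<close>. Hence a partite construction over this base yields a partite
  lemma for arbitrary strong copies of \<open>A\<close> in \<open>P\<close> on the same levels, and iterating the partite lemma
  over all \<open>a\<close>-subsets of \<open>{..<N}\<close> gives the theorem.\<close>

section \<open>The Hales--Jewett theorem\<close>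

text \<open>Cleanness is what gluing along two different lines needs. Copies on different lines
  share only vertices on the levels of one base copy of \<open>A\<close>. An edge of the first copy
  with at least \<open>t\<close> vertices in the second thus projects to an edge of a base copy of
  the amalgamated system that has at least \<open>t\<close> vertices in that copy of
  \<open>A\<close>. Cleanness makes the projection an edge of \<open>A\<close>, and then an edge of
  the base copy below the second copy. Over a plain Ramsey number the first conclusion can fail: an
  \<open>a\<close>-set may meet an edge over a \<open>b\<close>-set in \<open>t\<close> points
  although \<open>A\<close> has no edge there.

  What remains is the passage from \<open>t\<close> common vertices to the whole edge. It is done
  one coordinate of the words at a time, and it is the reason why copies of \<open>A\<close> may be
  glued along words at all.

  Hales-Jewett acts in two layers of the partite lemma: on the copies of \<open>A\<close> over a
  single word, so that their colour depends only on the word, and then on the words. The order never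
  interacts with the edges: it is carried by levels, which the maps returned by the partite lemma
  preserve.\<close>

definition words :: "nat \<Rightarrow> nat \<Rightarrow> nat list set" where
  "words M n = {w. length w = n \<and> set w \<subseteq> {..<M}}"

definition templates :: "nat \<Rightarrow> nat \<Rightarrow> nat option list set" where
  "templates M n = {\<tau>. length \<tau> = n \<and> None \<in> set \<tau> \<and> set \<tau> \<subseteq> insert None (Some ` {..<M})}"

definition fill :: "(nat \<Rightarrow> 'a) \<Rightarrow> 'a \<Rightarrow> nat option list \<Rightarrow> 'a list" where
  "fill g u \<tau> = map (case_option u g) \<tau>"

abbreviation subst :: "nat \<Rightarrow> nat option list \<Rightarrow> nat list" where
  "subst \<equiv> fill (\<lambda>c. c)"

lemma finite_words: "finite (words M n)"
  unfolding words_def using finite_lists_length_eq[of "{..<M}" n] by (simp add: conj_commute)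

lemma finite_templates: "finite (templates M n)"
proof (rule finite_subset)
  show "templates M n \<subseteq> {\<tau>. set \<tau> \<subseteq> insert None (Some ` {..<M}) \<and> length \<tau> = n}"
    by (auto simp: templates_def)
qed (rule finite_lists_length_eq, simp)

lemma subst_in_words: "\<tau> \<in> templates M n \<Longrightarrow> m < M' \<Longrightarrow> M \<le> M' \<Longrightarrow> subst m \<tau> \<in> words M' n"
  by (fastforce simp: words_def templates_def fill_def split: option.splits)

lemma templates_mono: "M \<le> M' \<Longrightarrow> templates M n \<subseteq> templates M' n"
  by (fastforce simp: templates_def)

lemma fill_append: "fill g u (\<sigma> @ \<tau>) = fill g u \<sigma> @ fill g u \<tau>"
  by (simp add: fill_def)

lemma fill_map_Some: "fill g u (map Some w) = map g w"
  by (simp add: fill_def)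

definition HJ_number :: "nat \<Rightarrow> nat \<Rightarrow> nat \<Rightarrow> bool" where
  "HJ_number M r n \<longleftrightarrow>
     (\<forall>\<chi>. (\<forall>w\<in>words M n. \<chi> w < r) \<longrightarrow> (\<exists>\<tau>\<in>templates M n. \<exists>c. \<forall>m<M. \<chi> (subst m \<tau>) = c))"

lemma HJ_number_finite_colours:
  assumes "HJ_number M (card K) n" "finite K" "\<And>w. w \<in> words M n \<Longrightarrow> \<chi> w \<in> K"
  shows "\<exists>\<tau>\<in>templates M n. \<exists>c. \<forall>m<M. \<chi> (subst m \<tau>) = c"
proof -
  obtain h where h: "bij_betw h K {0..<card K}"
    using assms(2) ex_bij_betw_finite_nat by blast
  have "\<forall>w\<in>words M n. (h \<circ> \<chi>) w < card K"
    using h assms(3) by (auto simp: bij_betw_def)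
  then obtain \<tau> c where \<tau>: "\<tau> \<in> templates M n" "\<forall>m<M. (h \<circ> \<chi>) (subst m \<tau>) = c"
    using assms(1) unfolding HJ_number_def by blast
  have "\<chi> (subst m \<tau>) = inv_into K h c" if "m < M" for m
    using \<tau> that h assms(3) subst_in_words[OF \<tau>(1) that le_refl]
    by (metis bij_betw_def comp_apply inv_into_f_f)
  then show ?thesis using \<tau>(1) by blast
qed

section \<open>Colour focusing\<close>

definition mono_line :: "nat \<Rightarrow> nat \<Rightarrow> (nat list \<Rightarrow> nat) \<Rightarrow> bool" where
  "mono_line M n \<chi> \<longleftrightarrow> (\<exists>\<tau>\<in>templates M n. \<exists>c. \<forall>m<M. \<chi> (subst m \<tau>) = c)"

text \<open>The \<open>s\<close> lines share the end point \<open>f\<close>, reached with the last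
  letter \<open>M\<close>, and have distinct colours on the letters below \<open>M\<close>. If
  \<open>f\<close> itself has one of these colours, the corresponding line is monochromatic.\<close>

definition focused :: "nat \<Rightarrow> nat \<Rightarrow> nat \<Rightarrow> nat \<Rightarrow> (nat list \<Rightarrow> nat) \<Rightarrow> bool" where
  "focused M r s n \<chi> \<longleftrightarrow>
     (\<exists>C f. C \<subseteq> {..<r} \<and> card C = s \<and> f \<in> words (Suc M) n \<and>
       (\<forall>c\<in>C. \<exists>\<tau>\<in>templates (Suc M) n. subst M \<tau> = f \<and> (\<forall>m<M. \<chi> (subst m \<tau>) = c)))"

text \<open>Words are split into a prefix and a suffix. On the prefix the smaller alphabet gives a
  line all of whose points induce the same colouring \<open>g\<close> of the suffixes; the induction
  hypothesis on \<open>s\<close> is then applied to \<open>g\<close>.\<close>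

lemma HJ_focus:
  assumes IH: "\<And>r. \<exists>n. HJ_number M r n" and M: "M > 0"
  shows "\<exists>n. \<forall>\<chi>. (\<forall>w\<in>words (Suc M) n. \<chi> w < r) \<longrightarrow>
      mono_line (Suc M) n \<chi> \<or>
      focused M r s n \<chi>"
proof (induction s)
  case 0
  have "[] \<in> words (Suc M) 0" by (simp add: words_def)
  then have "focused M r 0 0 \<chi>" for \<chi>
    unfolding focused_def by (intro exI[where x = "{}"] exI[where x = "[]"]) simp
  then show ?case by blast
next
  case (Suc s)
  let ?W = "words (Suc M)"
  from Suc obtain n where n: "\<And>\<chi>. \<forall>w\<in>?W n. \<chi> w < r \<Longrightarrow>
      mono_line (Suc M) n \<chi> \<or>
      focused M r s n \<chi>"
    by blast
  \<comment> \<open>The colour of a prefix is the whole colouring it induces on the suffixes;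
    restricting these functions to \<open>?W n\<close> keeps them finite in number.\<close>
  let ?K = "?W n \<rightarrow>\<^sub>E {..<r}"
  have K: "finite ?K" by (simp add: finite_PiE finite_words)
  obtain n' where n': "HJ_number M (card ?K) n'" using IH by blast
  show ?case
  proof (intro exI[of _ "n' + n"] allI impI)
    fix \<chi> :: "nat list \<Rightarrow> nat"
    assume \<chi>: "\<forall>w\<in>?W (n' + n). \<chi> w < r"
    have app: "u @ w \<in> ?W (n' + n)" if "u \<in> words M n' \<or> u \<in> ?W n'" "w \<in> ?W n" for u w
      using that by (fastforce simp: words_def)
    have "\<exists>\<sigma>\<in>templates M n'. \<exists>c. \<forall>m<M. (\<lambda>u. \<lambda>w\<in>?W n. \<chi> (u @ w)) (subst m \<sigma>) = c"
      by (rule HJ_number_finite_colours[OF n' K]) (use \<chi> app in auto)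
    then obtain \<sigma> g where \<sigma>: "\<sigma> \<in> templates M n'"
      and "\<forall>m<M. (\<lambda>w\<in>?W n. \<chi> (subst m \<sigma> @ w)) = g" by auto
    then have g: "\<chi> (subst m \<sigma> @ w) = g w" if "m < M" "w \<in> ?W n" for m w
      using that by (metis restrict_apply')
    have \<sigma>': "\<sigma> \<in> templates (Suc M) n'" using \<sigma> templates_mono[of M "Suc M"] by auto
    have Some_app: "map Some (subst 0 \<sigma>) @ \<tau> \<in> templates (Suc M) (n' + n)"
      if "\<tau> \<in> templates (Suc M) n" for \<tau>
      using that subst_in_words[OF \<sigma> _ le_refl, of 0] M by (fastforce simp: templates_def words_def)
    have app_tmp: "\<sigma> @ \<tau> \<in> templates (Suc M) (n' + n)" if "\<tau> \<in> templates (Suc M) n" for \<tau>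
      using that \<sigma>' by (fastforce simp: templates_def)
    have app_Some: "\<sigma> @ map Some f \<in> templates (Suc M) (n' + n)" if "f \<in> ?W n" for f
      using that \<sigma>' by (fastforce simp: templates_def words_def)
    have "\<forall>w\<in>?W n. g w < r"
      using g M \<chi> app subst_in_words[OF \<sigma> _ le_refl, of 0] by metis
    from n[OF this] consider
      (mono) \<tau> c where "\<tau> \<in> templates (Suc M) n" "\<forall>m<Suc M. g (subst m \<tau>) = c"
      | (focus) C f where "C \<subseteq> {..<r}" "card C = s" "f \<in> ?W n"
        "\<forall>c\<in>C. \<exists>\<tau>\<in>templates (Suc M) n. subst M \<tau> = f \<and> (\<forall>m<M. g (subst m \<tau>) = c)"
      unfolding mono_line_def focused_def by blast
    then show "mono_line (Suc M) (n' + n) \<chi> \<or>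
      focused M r (Suc s) (n' + n) \<chi>"
    proof cases
      case mono
      have "\<chi> (subst m (map Some (subst 0 \<sigma>) @ \<tau>)) = c" if "m < Suc M" for m
        using mono that g[OF M] subst_in_words[OF mono(1) that] by (simp add: fill_append fill_map_Some)
      then show ?thesis using Some_app[OF mono(1)] unfolding mono_line_def by blast
    next
      case focus
      \<comment> \<open>If the focus has one of the \<open>s\<close> colours already, its line
        closes up. Otherwise its colour is new: the old lines are prefixed by
        \<open>\<sigma>\<close>, and \<open>\<sigma>\<close> followed by the constant word
        \<open>f\<close> is a line of the new colour with the same focus.\<close>
      show ?thesis
      proof (cases "g f \<in> C")
        case True
        then obtain \<tau> where \<tau>: "\<tau> \<in> templates (Suc M) n" "subst M \<tau> = f" "\<forall>m<M. g (subst m \<tau>) = g f"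
          using focus(4) by blast
        have "\<chi> (subst m (map Some (subst 0 \<sigma>) @ \<tau>)) = g f" if "m < Suc M" for m
          using \<tau> that g[OF M] subst_in_words[OF \<tau>(1) that]
          by (cases "m = M") (simp_all add: fill_append fill_map_Some)
        then show ?thesis using Some_app[OF \<tau>(1)] unfolding mono_line_def by blast
      next
        case False
        let ?f = "subst M \<sigma> @ f"
        have "\<exists>\<tau>\<in>templates (Suc M) (n' + n). subst M \<tau> = ?f \<and> (\<forall>m<M. \<chi> (subst m \<tau>) = c)"
          if "c \<in> insert (g f) C" for c
        proof (cases "c = g f")
          case True
          then show ?thesis using app_Some[OF focus(3)] g[OF _ focus(3)]
            by (intro bexI[of _ "\<sigma> @ map Some f"]) (auto simp: fill_append fill_map_Some)
        next
          case False
          then have "c \<in> C" using that by simp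
          then obtain \<tau> where \<tau>: "\<tau> \<in> templates (Suc M) n" "subst M \<tau> = f" "\<forall>m<M. g (subst m \<tau>) = c"
            using bspec[OF focus(4)] by blast
          have "\<chi> (subst m (\<sigma> @ \<tau>)) = c" if "m < M" for m
            using g[OF that] subst_in_words[OF \<tau>(1), of m] \<tau>(3) that by (simp add: fill_append)
          then show ?thesis using app_tmp[OF \<tau>(1)] \<tau>(2)
            by (intro bexI[of _ "\<sigma> @ \<tau>"]) (auto simp: fill_append)
        qed
        moreover have "g f < r" using \<open>\<forall>w\<in>?W n. g w < r\<close> focus(3) by blast
        moreover have "card (insert (g f) C) = Suc s"
          using False focus(1,2) finite_subset[OF focus(1)] by simp
        moreover have "?f \<in> ?W (n' + n)"
          using app subst_in_words[OF \<sigma>', of M] focus(3) by auto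
        ultimately have "focused M r (Suc s) (n' + n) \<chi>" unfolding focused_def using focus(1)
          by (intro exI[of _ "insert (g f) C"] exI[of _ ?f] conjI ballI) auto
        then show ?thesis by blast
      qed
    qed
  qed
qed

theorem Hales_Jewett: "M > 0 \<Longrightarrow> \<exists>n. HJ_number M r n"
proof (induction M arbitrary: r)
  case (Suc M)
  show ?case
  proof (cases "M = 0")
    case True
    have "[None] \<in> templates (Suc M) 1" by (simp add: templates_def)
    then have "HJ_number (Suc M) r 1" unfolding HJ_number_def using True by blast
    then show ?thesis by blast
  next
    case False
    \<comment> \<open>\<open>Suc r\<close> focused lines would need more than \<open>r\<close>
      colours, so only a monochromatic line is left.\<close>
    have "\<not> focused M r (Suc r) n \<chi>" for n \<chi>
      using card_mono[of "{..<r}"] unfolding focused_def by fastforce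
    then show ?thesis
      using HJ_focus[of M r "Suc r"] Suc.IH False
      unfolding HJ_number_def mono_line_def[symmetric] by (metis neq0_conv)
  qed
qed simp

section \<open>Compatible copies and amalgams along lines\<close>

text \<open>One half of compatibility: only the edges in \<open>E'\<close> are constrained, so
  compatible copies satisfy it in both directions.\<close>

definition absorbs :: "nat \<Rightarrow> 'a set \<Rightarrow> 'a set set \<Rightarrow> 'a set set \<Rightarrow> bool" where
  "absorbs t V E E' \<longleftrightarrow> (\<forall>e\<in>E'. card (e \<inter> V) \<ge> t \<longrightarrow> e \<in> E)"

lemma absorbsD: "absorbs t V E E' \<Longrightarrow> e \<in> E' \<Longrightarrow> card (e \<inter> V) \<ge> t \<Longrightarrow> e \<in> E"
  by (simp add: absorbs_def)

definition partial_steiner :: "nat \<Rightarrow> nat \<Rightarrow> 'a set \<Rightarrow> 'a set set \<Rightarrow> bool" where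
  "partial_steiner k t V E \<longleftrightarrow>
     finite V \<and> E \<subseteq> [V]\<^bsup>k\<^esup> \<and> (\<forall>e\<in>E. \<forall>e'\<in>E. card (e \<inter> e') \<ge> t \<longrightarrow> e = e')"

text \<open>The unordered part of a strong embedding. Reflection of edges is a consequence of the
  absorption clause once \<open>t \<le> k\<close>, see \<open>strong_embedding_iff\<close>.\<close>

definition strong :: "nat \<Rightarrow> ('a \<Rightarrow> 'b) \<Rightarrow> 'a set \<Rightarrow> 'a set set \<Rightarrow> 'b set \<Rightarrow> 'b set set \<Rightarrow> bool" where
  "strong t f V E V' E' \<longleftrightarrow>
     inj_on f V \<and> f ` V \<subseteq> V' \<and> (`) f ` E \<subseteq> E' \<and> absorbs t (f ` V) ((`) f ` E) E'"

lemma partial_steinerD: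
  assumes "partial_steiner k t V E"
  shows "finite V" "e \<in> E \<Longrightarrow> e \<subseteq> V" "e \<in> E \<Longrightarrow> finite e" "e \<in> E \<Longrightarrow> card e = k"
    "e \<in> E \<Longrightarrow> e' \<in> E \<Longrightarrow> card (e \<inter> e') \<ge> t \<Longrightarrow> e = e'"
  using assms unfolding partial_steiner_def nsets_def by (auto dest: finite_subset)

lemma strong_id: "strong t id V E V E"
  by (auto simp: strong_def absorbs_def)

text \<open>Absorption composes: an edge with \<open>t\<close> vertices in the smaller image has
  them in the image of \<open>VB\<close>, so it comes from an edge in \<open>EB\<close>; pulled back
  along the injective \<open>g\<close>, that edge still has \<open>t\<close> vertices in the image
  of \<open>f\<close>.\<close>

lemma strong_comp:
  assumes f: "strong t f VA EA VB EB" and g: "strong t g VB EB VC EC"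
    and sub: "\<And>e. e \<in> EB \<Longrightarrow> e \<subseteq> VB" and fin: "\<And>e. e \<in> EC \<Longrightarrow> finite e"
  shows "strong t (g \<circ> f) VA EA VC EC"
proof -
  note f' = f[unfolded strong_def] and g' = g[unfolded strong_def]
  have "e \<in> (`) (g \<circ> f) ` EA" if e: "e \<in> EC" "card (e \<inter> (g \<circ> f) ` VA) \<ge> t" for e
  proof -
    have "card (e \<inter> g ` VB) \<ge> card (e \<inter> (g \<circ> f) ` VA)"
      using f' fin[OF e(1)] by (intro card_mono) auto
    then obtain e' where e': "e' \<in> EB" "e = g ` e'"
      using g' e unfolding absorbs_def by (metis (no_types, lifting) imageE order_trans)
    have "e \<inter> (g \<circ> f) ` VA = g ` (e' \<inter> f ` VA)"
      using e' f' sub[OF e'(1)] inj_on_image_Int[of g VB e' "f ` VA"] g' by (simp add: image_comp)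
    moreover have "inj_on g (e' \<inter> f ` VA)" using f' g' by (meson inf_le2 inj_on_subset subset_trans)
    ultimately have "card (e' \<inter> f ` VA) \<ge> t" using e(2) card_image by fastforce
    then obtain e'' where "e'' \<in> EA" "e' = f ` e''" using f' e'(1) unfolding absorbs_def by blast
    then show ?thesis using e' by (auto simp: image_comp)
  qed
  moreover have "inj_on (g \<circ> f) VA" using f' g' by (meson comp_inj_on inj_on_subset)
  ultimately show ?thesis
    using f' g' unfolding strong_def absorbs_def by (auto simp: image_subset_iff simp flip: image_image)
qed

text \<open>Agreement in \<open>t\<close> places makes the two images equal as sets. The levels,
  injective on \<open>f\<close>, then tell which vertex is which.\<close>

lemma agreement_extends:
  assumes \<E>: "\<And>e e'. e \<in> \<E> \<Longrightarrow> e' \<in> \<E> \<Longrightarrow> card (e \<inter> e') \<ge> t \<Longrightarrow> e = e'"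
    and h: "h ` f \<in> \<E>" "h' ` f \<in> \<E>"
    and l: "\<And>x. x \<in> f \<Longrightarrow> \<pi> (h x) = l x" "\<And>x. x \<in> f \<Longrightarrow> \<pi> (h' x) = l x" "inj_on l f"
    and S: "S \<subseteq> f" "finite f" "card S \<ge> t" "\<And>x. x \<in> S \<Longrightarrow> h x = h' x"
  shows "\<forall>x\<in>f. h x = h' x"
proof -
  have "inj_on h S" using l S(1) by (metis inj_on_def subsetD)
  then have "card (h ` S) \<ge> t" using S(3) by (simp add: card_image)
  moreover have "h ` S \<subseteq> h ` f \<inter> h' ` f" using S(1,4) by force
  ultimately have "card (h ` f \<inter> h' ` f) \<ge> t"
    using S(2) by (meson card_mono finite_Int finite_imageI order_trans)
  then have eq: "h ` f = h' ` f" using \<E> h by blast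
  show ?thesis
  proof
    fix x assume x: "x \<in> f"
    then obtain y where y: "y \<in> f" "h x = h' y" using eq by (metis imageE imageI)
    then have "x = y" using l x by (metis inj_onD)
    then show "h x = h' x" using y by simp
  qed
qed

text \<open>\<open>glue\<close> maps a copy into an amalgam along the line with template \<open>\<tau>\<close> over the alphabet of
  the letters \<open>\<eta> m\<close>: vertices on the levels \<open>l x\<close> of the letters become words, all other
  vertices remain private to the line.\<close>

definition word_vertex :: "(nat \<Rightarrow> 'x \<Rightarrow> nat) \<Rightarrow> nat list \<Rightarrow> 'x \<Rightarrow> nat" where
  "word_vertex \<eta> w x = to_nat (Inl (map (\<lambda>m. \<eta> m x) w) :: nat list + nat option list \<times> nat)"

definition glue :: "'x set \<Rightarrow> ('x \<Rightarrow> nat) \<Rightarrow> (nat \<Rightarrow> nat) \<Rightarrow> (nat \<Rightarrow> 'x \<Rightarrow> nat) \<Rightarrow> nat option list \<Rightarrow> nat \<Rightarrow> nat" where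
  "glue VA l \<pi> \<eta> \<tau> u =
     to_nat (if \<pi> u \<in> l ` VA then Inl (fill (\<lambda>m. \<eta> m (inv_into VA l (\<pi> u))) u \<tau>)
             else Inr (\<tau>, u) :: nat list + nat option list \<times> nat)"

text \<open>All entries of a word produced by \<open>glue\<close> lie on one level, so the first
  serves; it exists because a template contains a variable.\<close>

definition glue_proj :: "(nat \<Rightarrow> nat) \<Rightarrow> nat \<Rightarrow> nat" where
  "glue_proj \<pi> z =
     (case from_nat z :: nat list + nat option list \<times> nat of Inl ws \<Rightarrow> \<pi> (hd ws) | Inr p \<Rightarrow> \<pi> (snd p))"

locale letters =
  fixes VA :: "'x set" and l :: "'x \<Rightarrow> nat" and \<pi> :: "nat \<Rightarrow> nat"
    and \<eta> :: "nat \<Rightarrow> 'x \<Rightarrow> nat" and M :: nat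
  assumes inj_l: "inj_on l VA"
    and level_eta: "\<And>m x. m < M \<Longrightarrow> x \<in> VA \<Longrightarrow> \<pi> (\<eta> m x) = l x"
begin

abbreviation "gl \<equiv> glue VA l \<pi> \<eta>"

lemma glue_word: "x \<in> VA \<Longrightarrow> \<pi> u = l x \<Longrightarrow> gl \<tau> u = to_nat (Inl (fill (\<lambda>m. \<eta> m x) u \<tau>) :: nat list + nat option list \<times> nat)"
  using inj_l by (simp add: glue_def)

lemma glue_private: "\<pi> u \<notin> l ` VA \<Longrightarrow> gl \<tau> u = to_nat (Inr (\<tau>, u) :: nat list + nat option list \<times> nat)"
  by (simp add: glue_def)

text \<open>The link between lines and words: along the line \<open>\<tau>\<close> the copy of
  \<open>A\<close> given by the letter \<open>m\<close> lands on the copy spelled by the word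
  \<open>subst m \<tau>\<close>.\<close>

lemma glue_letter: "m < M \<Longrightarrow> x \<in> VA \<Longrightarrow> gl \<tau> (\<eta> m x) = word_vertex \<eta> (subst m \<tau>) x"
  by (auto simp: glue_word level_eta word_vertex_def fill_def split: option.split)

lemma fill_eqD:
  assumes "fill g u \<tau> = fill g' u' \<tau>" "None \<in> set \<tau>"
  shows "u = u'"
  using assms by (auto simp: fill_def)

text \<open>A variable position of the template displays \<open>u\<close> itself.\<close>

lemma inj_glue: 
  assumes "\<tau> \<in> templates M n"
  shows "inj (gl \<tau>)"
proof (rule injI)
  fix u u' assume eq: "gl \<tau> u = gl \<tau> u'"
  show "u = u'"
  proof (cases "\<pi> u \<in> l ` VA \<and> \<pi> u' \<in> l ` VA")
    case True
    then show ?thesis using eq assms by (auto simp: glue_def templates_def dest: fill_eqD)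
  next
    case False
    then show ?thesis using eq by (auto simp: glue_def split: if_splits)
  qed
qed

lemma glue_proj_glue:
  assumes "\<tau> \<in> templates M n"
  shows "glue_proj \<pi> (gl \<tau> u) = \<pi> u"
proof (cases "\<pi> u \<in> l ` VA")
  case True
  then obtain x where x: "x \<in> VA" "\<pi> u = l x" by auto
  obtain c \<sigma> where \<tau>: "\<tau> = c # \<sigma>" using assms by (cases \<tau>) (auto simp: templates_def)
  have "hd (fill (\<lambda>m. \<eta> m x) u \<tau>) = u \<or> (\<exists>m<M. hd (fill (\<lambda>m. \<eta> m x) u \<tau>) = \<eta> m x)"
    using assms by (auto simp: \<tau> fill_def templates_def)
  then show ?thesis using x level_eta by (auto simp: glue_word glue_proj_def)
qed (simp add: glue_private glue_proj_def)

text \<open>Private vertices remember their template, so different lines can meet only in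
  words.\<close>

lemma glue_eq_imp:
  assumes "\<tau> \<in> templates M n" "\<tau>' \<in> templates M n" "gl \<tau> u = gl \<tau>' u'" "\<tau> \<noteq> \<tau>'"
  shows "\<pi> u = \<pi> u' \<and> \<pi> u \<in> l ` VA"
  using assms glue_proj_glue by (metis Inr_inject Pair_inject glue_private to_nat_split from_nat_to_nat)

text \<open>Coordinatewise \<open>agreement_extends\<close>: in each coordinate the word shows a
  letter or the vertex put in for the variable, and along \<open>f\<close> either of them traces an
  edge in \<E>.\<close>

lemma fill_agreement_extends:
  assumes \<E>: "\<And>e e'. e \<in> \<E> \<Longrightarrow> e' \<in> \<E> \<Longrightarrow> card (e \<inter> e') \<ge> t \<Longrightarrow> e = e'"
    and f: "f \<subseteq> VA" "finite f" "\<And>m. m < M \<Longrightarrow> \<eta> m ` f \<in> \<E>"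
    and g: "g ` f \<in> \<E>" "\<And>x. x \<in> f \<Longrightarrow> \<pi> (g x) = l x"
    and g': "g' ` f \<in> \<E>" "\<And>x. x \<in> f \<Longrightarrow> \<pi> (g' x) = l x"
    and \<tau>: "\<tau> \<in> templates M n" "\<tau>' \<in> templates M n"
    and S: "S \<subseteq> f" "card S \<ge> t" "\<And>x. x \<in> S \<Longrightarrow> gl \<tau> (g x) = gl \<tau>' (g' x)"
    and x: "x \<in> f"
  shows "gl \<tau> (g x) = gl \<tau>' (g' x)"
proof -
  let ?h = "\<lambda>i x. case \<tau> ! i of None \<Rightarrow> g x | Some m \<Rightarrow> \<eta> m x"
  let ?h' = "\<lambda>i x. case \<tau>' ! i of None \<Rightarrow> g' x | Some m \<Rightarrow> \<eta> m x"
  have iff: "gl \<tau> (g y) = gl \<tau>' (g' y) \<longleftrightarrow> (\<forall>i<n. ?h i y = ?h' i y)" if "y \<in> f" for y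
  proof -
    have "gl \<tau> (g y) = gl \<tau>' (g' y) \<longleftrightarrow> fill (\<lambda>m. \<eta> m y) (g y) \<tau> = fill (\<lambda>m. \<eta> m y) (g' y) \<tau>'"
      using glue_word[OF subsetD[OF f(1) that] g(2)[OF that]]
        glue_word[OF subsetD[OF f(1) that] g'(2)[OF that]] by simp
    also have "\<dots> \<longleftrightarrow> (\<forall>i<n. ?h i y = ?h' i y)"
      using \<tau> by (simp add: list_eq_iff_nth_eq fill_def templates_def)
    finally show ?thesis .
  qed
  have lt: "\<tau> ! i = Some m \<Longrightarrow> m < M" "\<tau>' ! i = Some m \<Longrightarrow> m < M" if "i < n" for i m
    using that \<tau> nth_mem[of i \<tau>] nth_mem[of i \<tau>'] by (fastforce simp: templates_def)+
  have "\<forall>x\<in>f. ?h i x = ?h' i x" if i: "i < n" for i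
  proof (rule agreement_extends[OF \<E>, where \<pi> = \<pi> and l = l])
    show "?h i ` f \<in> \<E>" "?h' i ` f \<in> \<E>"
      using g(1) g'(1) f(3) lt[OF i] by (cases "\<tau> ! i"; cases "\<tau>' ! i"; simp)+
    show "\<pi> (?h i x) = l x" "\<pi> (?h' i x) = l x" if "x \<in> f" for x
      using g g' f(1) lt[OF i] level_eta that by (auto split: option.split)
    show "inj_on l f" using inj_l f(1) by (rule inj_on_subset)
    show "?h i x = ?h' i x" if "x \<in> S" for x using S(1,3) iff that i by blast
  qed (use S f in auto)
  then show ?thesis using iff x by blast
qed

end

section \<open>The partite construction over a clean base\<close>

text \<open>A stage of the partite construction: via \<open>\<pi>\<close>, the copy \<open>p\<close>
  lies over the base copy \<open>b \<kappa>\<close>. The last clause ranges over ordered pairs and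
  so expresses compatibility in both directions.\<close>

definition system :: "nat \<Rightarrow> nat set \<Rightarrow> nat set set \<Rightarrow> 'k set \<Rightarrow> ('k \<Rightarrow> nat \<Rightarrow> nat) \<Rightarrow>
    ('k \<times> (nat \<Rightarrow> nat)) set \<Rightarrow> (nat \<Rightarrow> nat) \<Rightarrow> bool" where
  "system t V E K b \<S> \<pi> \<longleftrightarrow>
     finite \<S> \<and>
     (\<forall>(\<kappa>, p)\<in>\<S>. \<kappa> \<in> K \<and> (\<forall>v\<in>V. \<pi> (p v) = b \<kappa> v)) \<and>
     (\<forall>(\<kappa>, p)\<in>\<S>. \<forall>(\<kappa>', q)\<in>\<S>. absorbs t (q ` V) ((`) q ` E) ((`) p ` E))"

text \<open>The base of a partite construction: the copies \<open>b \<kappa>\<close> of \<open>(V, E)\<close> may overlap badly with each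
  other, but every \<open>b \<kappa>\<close> meets every copy \<open>a \<omega>\<close> of \<open>(VA, EA)\<close> in a closed set.\<close>

locale clean_base =
  fixes k t :: nat and V :: "nat set" and E :: "nat set set" and VA :: "'x set" and EA :: "'x set set"
    and K :: "'k set" and b :: "'k \<Rightarrow> nat \<Rightarrow> nat" and \<Omega> :: "'w set" and a :: "'w \<Rightarrow> 'x \<Rightarrow> nat"
    and M :: nat and \<eta> :: "nat \<Rightarrow> 'x \<Rightarrow> nat"
  assumes steiner: "partial_steiner k t V E"
    and finite_VA: "finite VA" and edges_A: "\<And>e. e \<in> EA \<Longrightarrow> e \<subseteq> VA"
    and inj_b: "\<And>\<kappa>. \<kappa> \<in> K \<Longrightarrow> inj_on (b \<kappa>) V" and inj_a: "\<And>\<omega>. \<omega> \<in> \<Omega> \<Longrightarrow> inj_on (a \<omega>) VA"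
    and absorbs_a: "\<And>\<kappa> \<omega>. \<kappa> \<in> K \<Longrightarrow> \<omega> \<in> \<Omega> \<Longrightarrow> absorbs t (a \<omega> ` VA) ((`) (a \<omega>) ` EA) ((`) (b \<kappa>) ` E)"
    and absorbs_b: "\<And>\<kappa> \<omega>. \<kappa> \<in> K \<Longrightarrow> \<omega> \<in> \<Omega> \<Longrightarrow> absorbs t (b \<kappa> ` V) ((`) (b \<kappa>) ` E) ((`) (a \<omega>) ` EA)"
    and eta_verts: "\<And>m. m < M \<Longrightarrow> \<eta> m ` VA \<subseteq> V"
    and eta_edges: "\<And>m. m < M \<Longrightarrow> (`) (\<eta> m) ` EA \<subseteq> E"
begin

lemma system_inj:
  assumes "system t V E K b \<S> \<pi>" "(\<kappa>, p) \<in> \<S>"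
  shows "inj_on p V"
proof (rule inj_onI)
  have \<kappa>: "\<kappa> \<in> K" and \<pi>: "\<And>v. v \<in> V \<Longrightarrow> \<pi> (p v) = b \<kappa> v"
    using assms unfolding system_def by fast+
  fix u v assume "u \<in> V" "v \<in> V" "p u = p v"
  then show "u = v" using \<pi> inj_onD[OF inj_b[OF \<kappa>]] by metis
qed

text \<open>Compatibility turns the first edge into an edge of the copy \<open>q\<close>, where the
  Steiner property of \<open>(V, E)\<close> decides.\<close>

lemma system_edges:
  assumes S: "system t V E K b \<S> \<pi>" "(\<kappa>, p) \<in> \<S>" "(\<kappa>', q) \<in> \<S>"
    and e: "e \<in> E" "e' \<in> E" "card (p ` e \<inter> q ` e') \<ge> t"
  shows "p ` e = q ` e'"
proof -
  note st = partial_steinerD[OF steiner]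
  have "card (p ` e \<inter> q ` V) \<ge> card (p ` e \<inter> q ` e')"
    using st(2)[OF e(2)] st(3)[OF e(1)] by (intro card_mono) auto
  moreover have "absorbs t (q ` V) ((`) q ` E) ((`) p ` E)"
    using S unfolding system_def by fast
  ultimately obtain e'' where e'': "e'' \<in> E" "p ` e = q ` e''"
    using e unfolding absorbs_def by (metis (no_types, lifting) imageE image_eqI order_trans)
  have inj: "inj_on q V" using system_inj S by blast
  have "q ` e'' \<inter> q ` e' = q ` (e'' \<inter> e')"
    using inj_on_image_Int[OF inj] st(2) e'' e by metis
  then have "card (e'' \<inter> e') \<ge> t"
    using e(3) e''(2) card_image_le[of "e'' \<inter> e'" q] st(3)[OF e''(1)] by fastforce
  then show ?thesis using st(5) e''  e(2) by blast
qed

text \<open>One copy of the whole system is taken for every line over the alphabet of copies of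
  \<open>A\<close> above \<open>\<omega>\<close>; inside a monochromatic line all these copies of
  \<open>A\<close> get one colour. The work is to show that the glued copies stay
  compatible.\<close>

lemma amalgamation_step:
  assumes S: "system t V E K b \<S> \<pi>" and \<omega>: "\<omega> \<in> \<Omega>"
  shows "\<exists>\<S>' \<pi>'. system t V E K b \<S>' \<pi>' \<and> (\<forall>\<chi> :: nat set \<Rightarrow> nat. (\<forall>s. \<chi> s < r) \<longrightarrow>
    (\<exists>T. (\<forall>(\<kappa>, p)\<in>\<S>. (\<kappa>, T \<circ> p) \<in> \<S>') \<and>
      (\<exists>c. \<forall>(\<kappa>, p)\<in>\<S>. \<forall>m<M. (\<forall>x\<in>VA. b \<kappa> (\<eta> m x) = a \<omega> x) \<longrightarrow> \<chi> (T ` p ` \<eta> m ` VA) = c)))"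
proof -
  \<comment> \<open>The Hales-Jewett alphabet: the copies \<open>p \<circ> \<eta> m\<close> of
    \<open>A\<close> in the system whose projection is \<open>a \<omega>\<close>.\<close>
  define L where "L = (\<lambda>((\<kappa>, p), m). p \<circ> \<eta> m) `
      {((\<kappa>, p), m). (\<kappa>, p) \<in> \<S> \<and> m < M \<and> (\<forall>x\<in>VA. b \<kappa> (\<eta> m x) = a \<omega> x)}"
  have "finite \<S>" using S by (simp add: system_def)
  then have "finite L" unfolding L_def
    by (intro finite_imageI finite_subset[OF _ finite_cartesian_product[of \<S> "{..<M}"]]) auto
  then obtain h M' where L: "L = h ` {i. i < (M'::nat)}" using finite_imp_nat_seg_image_inj_on by metis
  have L_iff: "\<exists>i<M'. h i = p \<circ> \<eta> m" if "(\<kappa>, p) \<in> \<S>" "m < M" "\<forall>x\<in>VA. b \<kappa> (\<eta> m x) = a \<omega> x" for \<kappa> p m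
  proof -
    have "p \<circ> \<eta> m \<in> L" unfolding L_def using that by (intro image_eqI[of _ _ "((\<kappa>, p), m)"]) auto
    then show ?thesis using L by auto
  qed
  have h: "\<exists>\<kappa> p m. (\<kappa>, p) \<in> \<S> \<and> m < M \<and> (\<forall>x\<in>VA. b \<kappa> (\<eta> m x) = a \<omega> x) \<and> h i = p \<circ> \<eta> m" if "i < M'" for i
  proof -
    have "h i \<in> L" using L that by auto
    then show ?thesis unfolding L_def by auto
  qed
  have S_proj: "\<kappa> \<in> K" "v \<in> V \<Longrightarrow> \<pi> (p v) = b \<kappa> v" if "(\<kappa>, p) \<in> \<S>" for \<kappa> p v
    using S that unfolding system_def by fast+
  interpret letters VA "a \<omega>" \<pi> h M'
  proof
    show "inj_on (a \<omega>) VA" using inj_a \<omega> .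
    show "\<pi> (h i x) = a \<omega> x" if i: "i < M'" and x: "x \<in> VA" for i x
    proof -
      obtain \<kappa> p m where *: "(\<kappa>, p) \<in> \<S>" "m < M" "\<forall>x\<in>VA. b \<kappa> (\<eta> m x) = a \<omega> x" "h i = p \<circ> \<eta> m"
        using h[OF i] by blast
      moreover have "\<eta> m x \<in> V" using eta_verts[OF *(2)] x by auto
      ultimately show ?thesis using S_proj(2)[OF *(1)] x by simp
    qed
  qed
  show ?thesis
  proof (cases "M' = 0")
    case True
    \<comment> \<open>Nothing lies over \<open>\<omega>\<close>: the system is kept, and
      \<open>0\<close> is a dummy colour.\<close>
    have "\<exists>T. (\<forall>(\<kappa>, p)\<in>\<S>. (\<kappa>, T \<circ> p) \<in> \<S>) \<and>
      (\<exists>c. \<forall>(\<kappa>, p)\<in>\<S>. \<forall>m<M. (\<forall>x\<in>VA. b \<kappa> (\<eta> m x) = a \<omega> x) \<longrightarrow> \<chi> (T ` p ` \<eta> m ` VA) = c)"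
      for \<chi> :: "nat set \<Rightarrow> nat"
      using L_iff True by (intro exI[where x = "\<lambda>u. u"] conjI exI[where x = "0::nat"]) (fastforce simp: o_def)+
    then show ?thesis using S by blast
  next
    case False
    then obtain n where n: "HJ_number M' r n" using Hales_Jewett[of M' r] by auto
    let ?S = "(\<lambda>(\<tau>, (\<kappa>, p)). (\<kappa>, gl \<tau> \<circ> p)) ` (templates M' n \<times> \<S>)"
    note st = partial_steinerD[OF steiner]
    have "absorbs t ((gl \<tau>' \<circ> q) ` V) ((`) (gl \<tau>' \<circ> q) ` E) ((`) (gl \<tau> \<circ> p) ` E)"
      if \<tau>: "\<tau> \<in> templates M' n" "\<tau>' \<in> templates M' n" and p: "(\<kappa>, p) \<in> \<S>" and q: "(\<kappa>', q) \<in> \<S>" for \<tau> \<tau>' \<kappa> \<kappa>' p q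
      unfolding absorbs_def
    proof (intro ballI impI)
      fix d assume "d \<in> (`) (gl \<tau> \<circ> p) ` E" and card_d: "card (d \<inter> (gl \<tau>' \<circ> q) ` V) \<ge> t"
      then obtain e where e: "e \<in> E" and d: "d = gl \<tau> ` p ` e" by (auto simp: image_comp)
      show "d \<in> (`) (gl \<tau>' \<circ> q) ` E"
      proof (cases "\<tau> = \<tau>'")
        case True
        \<comment> \<open>On a single line \<open>gl \<tau>\<close> is injective, which reduces the
          claim to the compatibility of \<open>p\<close> and \<open>q\<close>.\<close>
        have "d \<inter> (gl \<tau>' \<circ> q) ` V = gl \<tau> ` (p ` e \<inter> q ` V)"
          using True d image_Int[OF inj_glue[OF \<tau>(1)]] by (simp add: image_comp)
        then have "card (p ` e \<inter> q ` V) \<ge> t"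
          using card_d card_image[OF inj_on_subset[OF inj_glue[OF \<tau>(1)]]] by simp
        then have "p ` e \<in> (`) q ` E" using S p q e unfolding system_def absorbs_def by blast
        then obtain e1 where "e1 \<in> E" "p ` e = q ` e1" by blast
        then show ?thesis using d True by (metis image_comp image_eqI)
      next
        case False
        note b\<kappa> = inj_b[OF S_proj(1)[OF p]] and b\<kappa>' = inj_b[OF S_proj(1)[OF q]]
        \<comment> \<open>Cleanness puts \<open>e\<close> over an edge of \<open>A\<close>; two words over such an edge that agree in \<open>t\<close> places
          agree everywhere, because in each coordinate they run through two edges of the system.\<close>
        define s where "s = {v \<in> e. gl \<tau> (p v) \<in> gl \<tau>' ` q ` V}"
        have s: "s \<subseteq> e" "finite s" using st(3)[OF e] by (auto simp: s_def)
        have "d \<inter> (gl \<tau>' \<circ> q) ` V \<subseteq> (\<lambda>v. gl \<tau> (p v)) ` s" by (auto simp: s_def d)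
        then have card_s: "card s \<ge> t"
          using card_d s(2) by (meson card_image_le card_mono finite_imageI order_trans)
        have s_levels: "\<exists>v'\<in>V. gl \<tau> (p v) = gl \<tau>' (q v') \<and> b \<kappa>' v' = b \<kappa> v \<and> b \<kappa> v \<in> a \<omega> ` VA" if "v \<in> s" for v
        proof -
          from that obtain v' where v': "v' \<in> V" "gl \<tau> (p v) = gl \<tau>' (q v')" and v: "v \<in> V"
            using st(2)[OF e] by (auto simp: s_def)
          show ?thesis using glue_eq_imp[OF \<tau> v'(2) False] S_proj(2)[OF p v] S_proj(2)[OF q v'(1)] v'
            by metis
        qed
        have card_bs: "card (b \<kappa> ` s) \<ge> t"
          using card_s s(1) st(2)[OF e] b\<kappa> by (metis card_image inj_on_subset)
        have "b \<kappa> ` s \<subseteq> b \<kappa> ` e \<inter> a \<omega> ` VA" using s_levels s(1) by auto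
        then have "card (b \<kappa> ` e \<inter> a \<omega> ` VA) \<ge> t"
          using card_bs st(3)[OF e] by (meson card_mono finite_Int finite_imageI order_trans)
        then obtain f where f: "f \<in> EA" "b \<kappa> ` e = a \<omega> ` f"
          using absorbsD[OF absorbs_a[OF S_proj(1)[OF p] \<omega>] imageI[OF e]] by blast
        have "b \<kappa> ` s \<subseteq> a \<omega> ` f \<inter> b \<kappa>' ` V"
          using s_levels image_mono[OF s(1), of "b \<kappa>"] unfolding f(2) by (metis (no_types, lifting) Int_greatest image_eqI image_subsetI)
        then have "card (a \<omega> ` f \<inter> b \<kappa>' ` V) \<ge> t"
          using card_bs st(3)[OF e] f(2) by (metis card_mono finite_Int finite_imageI order_trans)
        then obtain e' where e': "e' \<in> E" "a \<omega> ` f = b \<kappa>' ` e'"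
          using absorbsD[OF absorbs_b[OF S_proj(1)[OF q] \<omega>] imageI[OF f(1)]] by blast
        have fVA: "f \<subseteq> VA" "finite f" using edges_A[OF f(1)] finite_VA finite_subset by auto
        \<comment> \<open>Both copies are reparametrised by the edge \<open>f\<close> of
          \<open>A\<close>: \<open>g x\<close> and \<open>g' x\<close> are the vertices of
          \<open>p\<close> and \<open>q\<close> above \<open>a \<omega> x\<close>.\<close>
        define g where "g x = p (inv_into V (b \<kappa>) (a \<omega> x))" for x
        define g' where "g' x = q (inv_into V (b \<kappa>') (a \<omega> x))" for x
        have im: "(\<lambda>x. u (inv_into V (b \<mu>) (a \<omega> x))) ` f = u ` e1"
          if "inj_on (b \<mu>) V" "a \<omega> ` f = b \<mu> ` e1" "e1 \<in> E" for \<mu> e1 and u :: "nat \<Rightarrow> nat"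
        proof -
          have "(\<lambda>x. u (inv_into V (b \<mu>) (a \<omega> x))) ` f = u ` inv_into V (b \<mu>) ` a \<omega> ` f"
            by (simp only: image_image)
          then show ?thesis using that inv_into_image_cancel[OF that(1) st(2)[OF that(3)]] by simp
        qed
        have lev: "inv_into V (b \<mu>) (a \<omega> x) \<in> V \<and> b \<mu> (inv_into V (b \<mu>) (a \<omega> x)) = a \<omega> x"
          if "a \<omega> ` f = b \<mu> ` e1" "e1 \<in> E" "x \<in> f" for \<mu> e1 x
        proof -
          have "a \<omega> x \<in> b \<mu> ` V" using that st(2)[OF that(2)] by (metis image_eqI image_mono subsetD)
          then show ?thesis by (simp add: f_inv_into_f inv_into_into)
        qed
        have gf: "g ` f = p ` e" and gf': "g' ` f = q ` e'"
          using im[OF b\<kappa> f(2)[symmetric] e] im[OF b\<kappa>' e'(2,1)] by (simp_all add: g_def g'_def)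
        \<comment> \<open>All edges of the system: two of them with \<open>t\<close> common vertices
          coincide by \<open>system_edges\<close>, and the letters as well as \<open>g\<close> and
          \<open>g'\<close> map \<open>f\<close> onto members of this family.\<close>
        let ?EE = "{p ` e | \<kappa> p e. (\<kappa>, p) \<in> \<S> \<and> e \<in> E}"
        have "gl \<tau> (g x) = gl \<tau>' (g' x)" if "x \<in> f" for x
        proof (rule fill_agreement_extends[where \<E> = ?EE and S = "{x \<in> f. a \<omega> x \<in> b \<kappa> ` s}", OF _ fVA _ _ _ _ _ \<tau> _ _ _ that])
          show "d = d'" if "d \<in> ?EE" "d' \<in> ?EE" "t \<le> card (d \<inter> d')" for d d'
            using that system_edges[OF S] by blast
          show "h i ` f \<in> ?EE" if i: "i < M'" for i
          proof -
            obtain \<mu> p1 m where *: "(\<mu>, p1) \<in> \<S>" "m < M" "h i = p1 \<circ> \<eta> m"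
              using h[OF i] by blast
            moreover have "\<eta> m ` f \<in> E" using eta_edges[OF *(2)] f(1) by auto
            moreover have "h i ` f = p1 ` \<eta> m ` f" using *(3) by (simp add: image_image)
            ultimately show ?thesis by blast
          qed
          show "g ` f \<in> ?EE" "g' ` f \<in> ?EE" using gf gf' p q e e' by blast+
          show "\<pi> (g x) = a \<omega> x" "\<pi> (g' x) = a \<omega> x" if "x \<in> f" for x
            using lev[OF f(2)[symmetric] e that] lev[OF e'(2,1) that] S_proj(2)[OF p] S_proj(2)[OF q]
            by (auto simp: g_def g'_def)
          show "{x \<in> f. a \<omega> x \<in> b \<kappa> ` s} \<subseteq> f" by blast
          have "b \<kappa> ` s \<subseteq> a \<omega> ` f" using image_mono[OF s(1), of "b \<kappa>"] f(2) by simp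
          moreover have "X \<subseteq> a \<omega> ` {x \<in> f. a \<omega> x \<in> X}" if "X \<subseteq> a \<omega> ` f" for X
            using that by blast
          ultimately have "b \<kappa> ` s \<subseteq> a \<omega> ` {x \<in> f. a \<omega> x \<in> b \<kappa> ` s}" by simp
          then show "t \<le> card {x \<in> f. a \<omega> x \<in> b \<kappa> ` s}"
            using card_bs fVA(2) surj_card_le[of "{x \<in> f. a \<omega> x \<in> b \<kappa> ` s}" "b \<kappa> ` s" "a \<omega>"] by simp
          show "gl \<tau> (g x) = gl \<tau>' (g' x)" if x: "x \<in> {x \<in> f. a \<omega> x \<in> b \<kappa> ` s}" for x
          proof -
            obtain v where v: "v \<in> s" "a \<omega> x = b \<kappa> v" using x by blast
            then obtain v' where v': "v' \<in> V" "gl \<tau> (p v) = gl \<tau>' (q v')" "b \<kappa>' v' = b \<kappa> v"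
              using s_levels by blast
            have "v \<in> V" using v s(1) st(2)[OF e] by blast
            then have "inv_into V (b \<kappa>) (a \<omega> x) = v" "inv_into V (b \<kappa>') (a \<omega> x) = v'"
              using v v' inv_into_f_f[OF b\<kappa>] inv_into_f_f[OF b\<kappa>'] by metis+
            then show ?thesis using v' by (simp add: g_def g'_def)
          qed
        qed
        then have "gl \<tau> ` g ` f = gl \<tau>' ` g' ` f" by (simp add: image_image)
        then show ?thesis using d gf gf' e'(1) by (metis image_comp image_eqI)
      qed
    qed
    then have "system t V E K b ?S (glue_proj \<pi>)"
      using S S_proj glue_proj_glue finite_templates unfolding system_def
      by (auto simp: finite_cartesian_product)
    moreover have "\<exists>T. (\<forall>(\<kappa>, p)\<in>\<S>. (\<kappa>, T \<circ> p) \<in> ?S) \<and>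
      (\<exists>c. \<forall>(\<kappa>, p)\<in>\<S>. \<forall>m<M. (\<forall>x\<in>VA. b \<kappa> (\<eta> m x) = a \<omega> x) \<longrightarrow> \<chi> (T ` p ` \<eta> m ` VA) = c)"
      if \<chi>: "\<forall>s. \<chi> s < r" for \<chi> :: "nat set \<Rightarrow> nat"
    proof -
      \<comment> \<open>A word gets the colour of the copy of \<open>A\<close> that it spells in the
        amalgam.\<close>
      obtain \<tau> c where \<tau>: "\<tau> \<in> templates M' n" "\<forall>i<M'. \<chi> (word_vertex h (subst i \<tau>) ` VA) = c"
        using n[unfolded HJ_number_def, rule_format, of "\<lambda>w. \<chi> (word_vertex h w ` VA)"] \<chi> by blast
      have "\<chi> (gl \<tau> ` p ` \<eta> m ` VA) = c" if pm: "(\<kappa>, p) \<in> \<S>" "m < M" "\<forall>x\<in>VA. b \<kappa> (\<eta> m x) = a \<omega> x" for \<kappa> p m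
      proof -
        obtain i where i: "i < M'" "h i = p \<circ> \<eta> m" using L_iff[OF pm] by blast
        have "gl \<tau> ` p ` \<eta> m ` VA = (\<lambda>x. gl \<tau> (h i x)) ` VA" using i by (simp add: image_image)
        also have "\<dots> = word_vertex h (subst i \<tau>) ` VA" using glue_letter[OF i(1)] by (intro image_cong) auto
        finally show ?thesis using \<tau>(2) i(1) by simp
      qed
      then show ?thesis using \<tau>(1) by (intro exI[of _ "gl \<tau>"]) force
    qed
    ultimately show ?thesis by blast
  qed
qed

end

section \<open>Iterated amalgamation over the copies of \<open>A\<close> in the base\<close>

context clean_base
begin

definition uniform :: "(nat set \<Rightarrow> nat) \<Rightarrow> ('k \<times> (nat \<Rightarrow> nat)) set \<Rightarrow> (nat \<Rightarrow> nat) \<Rightarrow> 'w \<Rightarrow> bool" where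
  "uniform \<chi> \<S> T \<omega> \<longleftrightarrow>
     (\<exists>c. \<forall>(\<kappa>, p)\<in>\<S>. \<forall>m<M. (\<forall>x\<in>VA. b \<kappa> (\<eta> m x) = a \<omega> x) \<longrightarrow> \<chi> (T ` p ` \<eta> m ` VA) = c)"

text \<open>The colouring travels backwards through the amalgamations: the last one yields
  \<open>T2\<close>, and the earlier ones are applied to \<open>\<chi>\<close> composed with taking
  images under \<open>T2\<close>. Uniformity at the last \<open>\<omega>\<close> survives because
  \<open>T1\<close> sends each copy to a copy in \<open>\<S>1\<close>.\<close>

lemma partite_construction:
  assumes "system t V E K b \<S> \<pi>" "set ws \<subseteq> \<Omega>"
  shows "\<exists>\<S>' \<pi>'. system t V E K b \<S>' \<pi>' \<and> (\<forall>\<chi> :: nat set \<Rightarrow> nat. (\<forall>s. \<chi> s < r) \<longrightarrow>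
    (\<exists>T. (\<forall>(\<kappa>, p)\<in>\<S>. (\<kappa>, T \<circ> p) \<in> \<S>') \<and> (\<forall>\<omega>\<in>set ws. uniform \<chi> \<S> T \<omega>)))"
  using assms(2)
proof (induction ws)
  case Nil
  have "\<forall>(\<kappa>, p)\<in>\<S>. (\<kappa>, (\<lambda>u. u) \<circ> p) \<in> \<S>" by (auto simp: o_def)
  then show ?case using assms(1) by (metis empty_iff empty_set)
next
  case (Cons \<omega> ws)
  then have "set ws \<subseteq> \<Omega>" by simp
  from Cons.IH[OF this] obtain \<S>1 \<pi>1 where S1: "system t V E K b \<S>1 \<pi>1"
    and 1: "\<And>\<chi> :: nat set \<Rightarrow> nat. \<forall>s. \<chi> s < r \<Longrightarrow>
      \<exists>T. (\<forall>(\<kappa>, p)\<in>\<S>. (\<kappa>, T \<circ> p) \<in> \<S>1) \<and> (\<forall>\<omega>\<in>set ws. uniform \<chi> \<S> T \<omega>)"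
    by blast
  have "\<omega> \<in> \<Omega>" using Cons.prems by simp
  from amalgamation_step[OF S1 this, of r] obtain \<S>2 \<pi>2 where S2: "system t V E K b \<S>2 \<pi>2"
    and 2: "\<And>\<chi> :: nat set \<Rightarrow> nat. \<forall>s. \<chi> s < r \<Longrightarrow>
      \<exists>T. (\<forall>(\<kappa>, p)\<in>\<S>1. (\<kappa>, T \<circ> p) \<in> \<S>2) \<and> uniform \<chi> \<S>1 T \<omega>"
    unfolding uniform_def by blast
  show ?case
  proof (rule exI[of _ \<S>2], rule exI[of _ \<pi>2], intro conjI S2 allI impI)
    fix \<chi> :: "nat set \<Rightarrow> nat" assume \<chi>: "\<forall>s. \<chi> s < r"
    obtain T2 where T2: "\<And>\<kappa> p. (\<kappa>, p) \<in> \<S>1 \<Longrightarrow> (\<kappa>, T2 \<circ> p) \<in> \<S>2" "uniform \<chi> \<S>1 T2 \<omega>"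
      using 2[OF \<chi>] by blast
    have "\<forall>s. \<chi> (T2 ` s) < r" using \<chi> by blast
    from 1[OF this] obtain T1 where T1: "\<And>\<kappa> p. (\<kappa>, p) \<in> \<S> \<Longrightarrow> (\<kappa>, T1 \<circ> p) \<in> \<S>1"
      "\<And>\<omega>. \<omega> \<in> set ws \<Longrightarrow> uniform (\<lambda>s. \<chi> (T2 ` s)) \<S> T1 \<omega>"
      by blast
    have im: "(T2 \<circ> T1) ` s = T2 ` T1 ` s" "T2 ` (T1 \<circ> p) ` s = T2 ` T1 ` p ` s" for s and p :: "nat \<Rightarrow> nat"
      by (simp_all add: image_image)
    have "uniform \<chi> \<S> (T2 \<circ> T1) \<omega>'" if \<omega>': "\<omega>' \<in> set ws" for \<omega>'
      using T1(2)[OF \<omega>'] unfolding uniform_def im .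
    moreover have "uniform \<chi> \<S> (T2 \<circ> T1) \<omega>"
    proof -
      obtain c where c: "\<And>\<kappa> p m. (\<kappa>, p) \<in> \<S>1 \<Longrightarrow> m < M \<Longrightarrow> \<forall>x\<in>VA. b \<kappa> (\<eta> m x) = a \<omega> x \<Longrightarrow>
          \<chi> (T2 ` p ` \<eta> m ` VA) = c"
        using T2(2) unfolding uniform_def by blast
      show ?thesis unfolding uniform_def im using c[OF T1(1)] unfolding im by blast
    qed
    moreover have "(\<kappa>, (T2 \<circ> T1) \<circ> p) \<in> \<S>2" if "(\<kappa>, p) \<in> \<S>" for \<kappa> p
      using T2(1)[OF T1(1)[OF that]] by (simp add: o_assoc)
    ultimately show "\<exists>T. (\<forall>(\<kappa>, p)\<in>\<S>. (\<kappa>, T \<circ> p) \<in> \<S>2) \<and> (\<forall>\<omega>'\<in>set (\<omega> # ws). uniform \<chi> \<S> T \<omega>')"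
      by (intro exI[of _ "T2 \<circ> T1"]) auto
  qed
qed

lemma system_union:
  assumes S: "system t V E K b \<S> \<pi>"
  defines "V' \<equiv> \<Union>(\<kappa>, p)\<in>\<S>. p ` V" and "E' \<equiv> \<Union>(\<kappa>, p)\<in>\<S>. (`) p ` E"
  shows "partial_steiner k t V' E'" "(\<kappa>, p) \<in> \<S> \<Longrightarrow> strong t p V E V' E'"
proof -
  note st = partial_steinerD[OF steiner]
  have "finite V'" using S st(1) unfolding system_def V'_def by auto
  moreover have "E' \<subseteq> [V']\<^bsup>k\<^esup>"
  proof
    fix d assume "d \<in> E'"
    then obtain \<kappa> p e where d: "(\<kappa>, p) \<in> \<S>" "e \<in> E" "d = p ` e" unfolding E'_def by auto
    then have "card d = k" "finite d"
      using st(2,3,4)[OF d(2)] system_inj[OF S d(1)] by (auto simp: card_image inj_on_subset)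
    then show "d \<in> [V']\<^bsup>k\<^esup>" using d st(2)[OF d(2)] unfolding nsets_def V'_def by auto
  qed
  moreover have "d = d'" if d: "d \<in> E'" "d' \<in> E'" "card (d \<inter> d') \<ge> t" for d d'
  proof -
    obtain \<kappa> p e \<kappa>' q e' where "(\<kappa>, p) \<in> \<S>" "e \<in> E" "d = p ` e" "(\<kappa>', q) \<in> \<S>" "e' \<in> E" "d' = q ` e'"
      using d(1,2) unfolding E'_def by auto
    then show ?thesis using system_edges[OF S] d(3) by metis
  qed
  ultimately show "partial_steiner k t V' E'" unfolding partial_steiner_def by blast
  assume p: "(\<kappa>, p) \<in> \<S>"
  have "absorbs t (p ` V) ((`) p ` E) E'"
    unfolding absorbs_def
  proof (intro ballI impI)
    fix d assume d: "d \<in> E'" "card (d \<inter> p ` V) \<ge> t"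
    then obtain \<kappa>' q where q: "(\<kappa>', q) \<in> \<S>" "d \<in> (`) q ` E" unfolding E'_def by auto
    then have "absorbs t (p ` V) ((`) p ` E) ((`) q ` E)" using S p unfolding system_def by blast
    then show "d \<in> (`) p ` E" using q(2) d(2) by (rule absorbsD)
  qed
  then show "strong t p V E V' E'"
    using system_inj[OF S p] p unfolding strong_def V'_def E'_def by (intro conjI) auto
qed

end

section \<open>Lines and words as a clean base\<close>

context letters
begin

text \<open>Making position \<open>i\<close> of \<open>w\<close> a variable exhibits the word as a
  point of another line, so that results on two lines apply to a line and a word. As
  \<open>\<tau>\<close> is free at \<open>i\<close>, a vertex \<open>v\<close> of its line is
  displayed there unchanged and can be compared with the letter \<open>w ! i\<close>.\<close>

lemma word_vertex_letter:
  assumes \<tau>: "\<tau> \<in> templates M n" "i < n" "\<tau> ! i = None" and w: "w \<in> words M n" and x: "x \<in> VA"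
  shows "(map Some w)[i := None] \<in> templates M n"
    "word_vertex \<eta> w x = gl ((map Some w)[i := None]) (\<eta> (w ! i) x)"
    "gl \<tau> v = word_vertex \<eta> w x \<Longrightarrow> v = \<eta> (w ! i) x"
proof -
  let ?\<tau> = "(map Some w)[i := None]"
  have len: "length w = n" "w ! i < M" using w \<tau>(2) nth_mem[of i w] unfolding words_def by blast+
  show \<tau>': "?\<tau> \<in> templates M n"
    using w \<tau>(2) len set_update_subset_insert[of "map Some w" i None]
    by (fastforce simp: templates_def words_def set_update_memI)
  have "subst (w ! i) ?\<tau> = w"
    using len \<tau>(2) by (intro nth_equalityI) (auto simp: fill_def nth_list_update split: option.split)
  then show eq: "word_vertex \<eta> w x = gl ?\<tau> (\<eta> (w ! i) x)"
    using glue_letter[OF len(2) x, of ?\<tau>] by simp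
  assume "gl \<tau> v = word_vertex \<eta> w x"
  then have v: "gl \<tau> v = gl ?\<tau> (\<eta> (w ! i) x)" using eq by simp
  then have "\<pi> v = l x"
    using glue_proj_glue[OF \<tau>(1)] glue_proj_glue[OF \<tau>'] level_eta[OF len(2) x] by metis
  then have "fill (\<lambda>m. \<eta> m x) v \<tau> ! i = fill (\<lambda>m. \<eta> m x) (\<eta> (w ! i) x) ?\<tau> ! i"
    using v glue_word[OF x] level_eta[OF len(2) x] by simp
  then show "v = \<eta> (w ! i) x"
    using \<tau> len by (simp add: fill_def templates_def)
qed

end

locale partite = letters VA l lev \<eta> M
  for k t :: nat and V :: "nat set" and E :: "nat set set" and lev :: "nat \<Rightarrow> nat"
    and VA :: "'x set" and EA :: "'x set set" and l :: "'x \<Rightarrow> nat" and \<eta> :: "nat \<Rightarrow> 'x \<Rightarrow> nat" and M :: nat +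
  assumes steiner: "partial_steiner k t V E" and t: "t > 0"
    and finite_VA: "finite VA" and edges_A: "\<And>e. e \<in> EA \<Longrightarrow> e \<subseteq> VA"
    and strong_eta: "\<And>m. m < M \<Longrightarrow> strong t (\<eta> m) VA EA V E"
begin

text \<open>The word is treated as a point of the line \<open>?\<tau>\<close>. At the free
  coordinate \<open>i\<close> of \<open>\<tau>\<close> the common vertices must show the letter
  \<open>w ! i\<close>; this provides the \<open>t\<close> places of agreement for
  \<open>fill_agreement_extends\<close>.\<close>

lemma word_glue_agreement:
  assumes \<tau>: "\<tau> \<in> templates M n" "i < n" "\<tau> ! i = None" and w: "w \<in> words M n" and f: "f \<in> EA"
    and s: "s \<subseteq> f" "card s \<ge> t" "\<And>x. x \<in> s \<Longrightarrow> word_vertex \<eta> w x \<in> gl \<tau> ` V"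
  shows "gl \<tau> ` \<eta> (w ! i) ` f = word_vertex \<eta> w ` f"
proof -
  note st = partial_steinerD[OF steiner]
  let ?\<tau> = "(map Some w)[i := None]" and ?h = "\<eta> (w ! i)"
  have fVA: "f \<subseteq> VA" "finite f" using edges_A[OF f] finite_VA finite_subset by auto
  have wi: "w ! i < M" using w \<tau>(2) nth_mem[of i w] unfolding words_def by blast
  have \<eta>E: "\<eta> m ` f \<in> E" if "m < M" for m using strong_eta[OF that] f unfolding strong_def by blast
  have word: "word_vertex \<eta> w x = gl ?\<tau> (?h x)" if "x \<in> f" for x
    using word_vertex_letter(2)[OF \<tau> w] fVA(1) that by blast
  \<comment> \<open>\<open>word_vertex_letter\<close> is stated for a vertex \<open>x\<close> of
    \<open>A\<close>, so an empty \<open>f\<close> is split off.\<close>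
  have "?\<tau> \<in> templates M n \<or> f = {}" using word_vertex_letter(1)[OF \<tau> w] fVA by blast
  then have "gl \<tau> (?h x) = word_vertex \<eta> w x" if x: "x \<in> f" for x
  proof
    assume \<tau>': "?\<tau> \<in> templates M n"
    have "gl \<tau> (?h x) = gl ?\<tau> (?h x)"
    proof (rule fill_agreement_extends[where \<E> = E and S = s and t = t, OF st(5) fVA \<eta>E \<eta>E _ \<eta>E _ \<tau>(1) \<tau>' s(1,2) _ x])
      show "gl \<tau> (?h y) = gl ?\<tau> (?h y)" if y: "y \<in> s" for y
      proof -
        obtain v where v: "gl \<tau> v = word_vertex \<eta> w y" using s(3)[OF y] by auto
        have "y \<in> f" "y \<in> VA" using y s(1) fVA(1) by auto
        then show ?thesis using v word_vertex_letter(3)[OF \<tau> w _ v] word[of y] by simp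
      qed
    qed (use level_eta[OF wi] fVA(1) wi in auto)
    then show ?thesis using word[OF x] by simp
  qed (use x in simp)
  then show ?thesis by (simp add: image_image)
qed

text \<open>Strength of the letters enters in the first claim: an edge of the line with
  \<open>t\<close> vertices on the word pulls back to an edge in \<open>E\<close> with
  \<open>t\<close> vertices in the letter \<open>w ! i\<close>, hence to the image of an edge of
  \<open>A\<close>. After that, both claims rest on \<open>word_glue_agreement\<close>.\<close>

lemma base_clean:
  assumes \<tau>: "\<tau> \<in> templates M n" and w: "w \<in> words M n"
  shows "absorbs t (word_vertex \<eta> w ` VA) ((`) (word_vertex \<eta> w) ` EA) ((`) (gl \<tau>) ` E)"
    and "absorbs t (gl \<tau> ` V) ((`) (gl \<tau>) ` E) ((`) (word_vertex \<eta> w) ` EA)"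
proof -
  note st = partial_steinerD[OF steiner]
  obtain i where i: "i < n" "\<tau> ! i = None" using \<tau> by (auto simp: templates_def in_set_conv_nth)
  let ?h = "\<eta> (w ! i)"
  have wi: "w ! i < M" using w i nth_mem[of i w] unfolding words_def by blast
  note str = strong_eta[OF wi, unfolded strong_def]
  show "absorbs t (gl \<tau> ` V) ((`) (gl \<tau>) ` E) ((`) (word_vertex \<eta> w) ` EA)"
    unfolding absorbs_def
  proof (intro ballI impI)
    fix d assume "d \<in> (`) (word_vertex \<eta> w) ` EA" and card_d: "card (d \<inter> gl \<tau> ` V) \<ge> t"
    then obtain f where f: "f \<in> EA" "d = word_vertex \<eta> w ` f" by blast
    define s where "s = {x \<in> f. word_vertex \<eta> w x \<in> gl \<tau> ` V}"
    have s: "s \<subseteq> f" "finite s" using edges_A[OF f(1)] finite_VA by (auto simp: s_def intro: finite_subset)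
    have "d \<inter> gl \<tau> ` V \<subseteq> word_vertex \<eta> w ` s" using f by (auto simp: s_def)
    then have "card s \<ge> t"
      using card_d s(2) by (meson card_image_le card_mono finite_imageI order_trans)
    from word_glue_agreement[OF \<tau> i w f(1) s(1) this] have "gl \<tau> ` ?h ` f = d"
      using f(2) by (simp add: s_def)
    moreover have "?h ` f \<in> E" using str f(1) by blast
    ultimately show "d \<in> (`) (gl \<tau>) ` E" by blast
  qed
  show "absorbs t (word_vertex \<eta> w ` VA) ((`) (word_vertex \<eta> w) ` EA) ((`) (gl \<tau>) ` E)"
    unfolding absorbs_def
  proof (intro ballI impI)
    fix d assume "d \<in> (`) (gl \<tau>) ` E" and card_d: "card (d \<inter> word_vertex \<eta> w ` VA) \<ge> t"
    then obtain e where e: "e \<in> E" "d = gl \<tau> ` e" by blast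
    define s where "s = {x \<in> VA. word_vertex \<eta> w x \<in> d}"
    have s: "s \<subseteq> VA" "finite s" using finite_VA by (auto simp: s_def)
    have "d \<inter> word_vertex \<eta> w ` VA \<subseteq> word_vertex \<eta> w ` s" by (auto simp: s_def)
    then have card_s: "card s \<ge> t"
      using card_d s(2) by (meson card_image_le card_mono finite_imageI order_trans)
    have he: "?h x \<in> e" "word_vertex \<eta> w x \<in> gl \<tau> ` V" if "x \<in> s" for x
    proof -
      obtain v where v: "v \<in> e" "gl \<tau> v = word_vertex \<eta> w x" using \<open>x \<in> s\<close> e(2) by (auto simp: s_def)
      then have "v = ?h x" using word_vertex_letter(3)[OF \<tau> i w] s(1) that by blast
      then show "?h x \<in> e" "word_vertex \<eta> w x \<in> gl \<tau> ` V" using v st(2)[OF e(1)] by (auto intro!: image_eqI[of _ _ v])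
    qed
    have "card (?h ` s) \<ge> t" using card_s str s(1) by (metis card_image inj_on_subset)
    moreover have "?h ` s \<subseteq> e \<inter> ?h ` VA" using he s(1) by blast
    ultimately have "card (e \<inter> ?h ` VA) \<ge> t"
      using st(3)[OF e(1)] by (meson card_mono finite_Int order_trans)
    then obtain f where f: "f \<in> EA" "e = ?h ` f" using str e(1) unfolding absorbs_def by blast
    have "s \<subseteq> f"
    proof
      fix x assume x: "x \<in> s"
      then obtain y where "y \<in> f" "?h x = ?h y" using he(1) f(2) by blast
      then show "x \<in> f" using str x s(1) edges_A[OF f(1)] by (metis inj_onD subsetD)
    qed
    from word_glue_agreement[OF \<tau> i w f(1) this card_s he(2)]
    show "d \<in> (`) (word_vertex \<eta> w) ` EA" using e(2) f by auto
  qed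
qed

text \<open>The base consists of the lines, as copies of \<open>(V, E)\<close>, and of the words, as
  copies of \<open>A\<close>. A vertex of the result lies over a vertex of the base, which in turn
  has a level; so the new level map is a composite of two projections.\<close>

theorem partite_lemma:
  assumes r: "r > 0"
  shows "\<exists>V' E' lev'. partial_steiner k t V' E' \<and> (\<forall>\<chi> :: nat set \<Rightarrow> nat. (\<forall>s. \<chi> s < r) \<longrightarrow>
    (\<exists>\<phi>. strong t \<phi> V E V' E' \<and> (\<forall>v\<in>V. lev' (\<phi> v) = lev v) \<and> (\<exists>c. \<forall>m<M. \<chi> (\<phi> ` \<eta> m ` VA) = c)))"
proof (cases "M = 0")
  case True
  have "\<exists>\<phi>. strong t \<phi> V E V E \<and> (\<forall>v\<in>V. lev (\<phi> v) = lev v)" using strong_id by (metis id_apply)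
  then show ?thesis using steiner True by (metis less_nat_zero_code)
next
  case False
  then obtain n where n: "HJ_number M r n" using Hales_Jewett[of M r] by auto
  \<comment> \<open>The template obtained for a constant colouring contains a variable, so
    \<open>n\<close> is positive. This makes \<open>word_vertex\<close> injective: the first entry
    of a word reveals the level of \<open>x\<close>.\<close>
  then have n_pos: "n > 0"
    using r unfolding HJ_number_def templates_def by (auto dest!: spec[of _ "\<lambda>_. 0"])
  interpret clean_base k t V E VA EA "templates M n" gl "words M n" "word_vertex \<eta>" M \<eta>
  proof
    show "inj_on (gl \<tau>) V" if "\<tau> \<in> templates M n" for \<tau> using inj_glue[OF that] by (rule inj_on_subset) simp
    show "inj_on (word_vertex \<eta> w) VA" if w_in: "w \<in> words M n" for w
    proof (rule inj_onI)
      fix x y assume xy: "x \<in> VA" "y \<in> VA" "word_vertex \<eta> w x = word_vertex \<eta> w y"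
      obtain m u where w: "w = m # u" using w_in n_pos by (cases w) (auto simp: words_def)
      then have "m < M" using w_in by (auto simp: words_def)
      moreover have "\<eta> m x = \<eta> m y" using xy(3) w by (simp add: word_vertex_def)
      ultimately show "x = y" using level_eta xy(1,2) inj_l by (metis inj_onD)
    qed
    show "\<eta> m ` VA \<subseteq> V" "(`) (\<eta> m) ` EA \<subseteq> E" if "m < M" for m
      using strong_eta[OF that] unfolding strong_def by auto
  qed (use steiner finite_VA edges_A base_clean in auto)
  \<comment> \<open>The initial system has one private copy of \<open>(V, E)\<close> for each line;
    disjoint copies are compatible because \<open>t > 0\<close>.\<close>
  define p0 where "p0 \<tau> v = to_nat (\<tau> :: nat option list, v :: nat)" for \<tau> v
  define S0 where "S0 = (\<lambda>\<tau>. (\<tau>, p0 \<tau>)) ` templates M n"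
  define \<pi>0 where "\<pi>0 z = (case from_nat z of (\<tau>, v) \<Rightarrow> gl \<tau> v)" for z
  have disj: "p0 \<tau> ` X \<inter> p0 \<tau>' ` Y = {}" if "\<tau> \<noteq> \<tau>'" for \<tau> \<tau>' X Y using that by (auto simp: p0_def)
  have "absorbs t (p0 \<tau>' ` V) ((`) (p0 \<tau>') ` E) ((`) (p0 \<tau>) ` E)" for \<tau> \<tau>'
    using disj[of \<tau> \<tau>'] t by (cases "\<tau> = \<tau>'") (auto simp: absorbs_def)
  then have "system t V E (templates M n) gl S0 \<pi>0"
    unfolding system_def S0_def by (auto simp: finite_templates \<pi>0_def p0_def)
  moreover obtain ws where ws: "set ws = words M n" using finite_list[OF finite_words] by blast
  ultimately obtain \<S> \<pi> where S: "system t V E (templates M n) gl \<S> \<pi>"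
    and \<chi>: "\<And>\<chi> :: nat set \<Rightarrow> nat. \<forall>s. \<chi> s < r \<Longrightarrow>
      \<exists>T. (\<forall>(\<kappa>, p)\<in>S0. (\<kappa>, T \<circ> p) \<in> \<S>) \<and> (\<forall>w\<in>words M n. uniform \<chi> S0 T w)"
    using partite_construction[of S0 \<pi>0 ws r] by auto
  define V' where "V' = (\<Union>(\<kappa>, p)\<in>\<S>. p ` V)"
  define E' where "E' = (\<Union>(\<kappa>, p)\<in>\<S>. (`) p ` E)"
  show ?thesis
  proof (rule exI[of _ V'], rule exI[of _ E'], rule exI[of _ "glue_proj lev \<circ> \<pi>"], intro conjI allI impI)
    show "partial_steiner k t V' E'" using system_union(1)[OF S] unfolding V'_def E'_def .
    fix \<chi> :: "nat set \<Rightarrow> nat" assume r: "\<forall>s. \<chi> s < r"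
    obtain T where T: "\<And>\<tau>. \<tau> \<in> templates M n \<Longrightarrow> (\<tau>, T \<circ> p0 \<tau>) \<in> \<S>"
      "\<And>w. w \<in> words M n \<Longrightarrow> uniform \<chi> S0 T w"
      using \<chi>[OF r] unfolding S0_def by auto
    \<comment> \<open>The colour of a word is the common colour of the copies of \<open>A\<close>
      above it. A value \<open>c \<ge> r\<close> is possible only if no copy lies above the word,
      and any colour below \<open>r\<close> may then replace it.\<close>
    have "\<exists>c<r. \<forall>\<tau>\<in>templates M n. \<forall>m<M. subst m \<tau> = w \<longrightarrow> \<chi> (T ` p0 \<tau> ` \<eta> m ` VA) = c"
      if w: "w \<in> words M n" for w
    proof -
      obtain c where c: "\<forall>(\<kappa>, p)\<in>S0. \<forall>m<M. (\<forall>x\<in>VA. gl \<kappa> (\<eta> m x) = word_vertex \<eta> w x) \<longrightarrow>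
          \<chi> (T ` p ` \<eta> m ` VA) = c"
        using T(2)[OF w] unfolding uniform_def by blast
      then have c': "\<forall>\<tau>\<in>templates M n. \<forall>m<M. subst m \<tau> = w \<longrightarrow> \<chi> (T ` p0 \<tau> ` \<eta> m ` VA) = c"
        using glue_letter unfolding S0_def by auto
      show ?thesis
      proof (cases "c < r")
        case False
        then show ?thesis using c' r \<open>0 < r\<close> by metis
      qed (use c' in blast)
    qed
    then obtain C where C: "\<And>w. w \<in> words M n \<Longrightarrow> C w < r"
      "\<And>w \<tau> m. w \<in> words M n \<Longrightarrow> \<tau> \<in> templates M n \<Longrightarrow> m < M \<Longrightarrow> subst m \<tau> = w \<Longrightarrow>
        \<chi> (T ` p0 \<tau> ` \<eta> m ` VA) = C w"
      by metis
    \<comment> \<open>The dimension \<open>n\<close> that shaped the base now yields a monochromatic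
      line of words, and the copy above this line is the one sought.\<close>
    obtain \<tau> c where \<tau>: "\<tau> \<in> templates M n" "\<forall>m<M. C (subst m \<tau>) = c"
      using n C(1) unfolding HJ_number_def by blast
    have "(glue_proj lev \<circ> \<pi>) ((T \<circ> p0 \<tau>) v) = lev v" if "v \<in> V" for v
    proof -
      have "\<pi> ((T \<circ> p0 \<tau>) v) = gl \<tau> v" using S T(1)[OF \<tau>(1)] that unfolding system_def by blast
      then show ?thesis using glue_proj_glue[OF \<tau>(1)] by simp
    qed
    moreover have "strong t (T \<circ> p0 \<tau>) V E V' E'"
      using system_union(2)[OF S T(1)[OF \<tau>(1)]] unfolding V'_def E'_def .
    moreover have "\<chi> ((T \<circ> p0 \<tau>) ` \<eta> m ` VA) = c" if "m < M" for m
      using C(2)[OF subst_in_words[OF \<tau>(1) that le_refl] \<tau>(1) that refl] \<tau>(2) that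
      by (simp add: image_image)
    ultimately show "\<exists>\<phi>. strong t \<phi> V E V' E' \<and> (\<forall>v\<in>V. (glue_proj lev \<circ> \<pi>) (\<phi> v) = lev v) \<and>
        (\<exists>c. \<forall>m<M. \<chi> (\<phi> ` \<eta> m ` VA) = c)"
      by blast
  qed
qed

end

section \<open>Iterating the partite lemma\<close>

lemma strong_cong:
  assumes "strong t f V E V' E'" "\<And>x. x \<in> V \<Longrightarrow> g x = f x" "\<And>e. e \<in> E \<Longrightarrow> e \<subseteq> V"
  shows "strong t g V E V' E'"
proof -
  have "g ` V = f ` V" using assms(2) by (rule image_cong[OF refl])
  moreover have "g ` e = f ` e" if "e \<in> E" for e using assms(2,3) that by (intro image_cong) auto
  then have "(`) g ` E = (`) f ` E" by (rule image_cong[OF refl])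
  moreover have "inj_on g V \<longleftrightarrow> inj_on f V" using assms(2) by (rule inj_on_cong)
  ultimately show ?thesis using assms(1) unfolding strong_def by simp
qed

text \<open>Each level map costs one application of the partite lemma, to the system reached so far
  and all its strong copies of \<open>A\<close> on these levels. Strong embeddings compose, so the
  copies in the original system are among those treated.\<close>

lemma iterated_partite_lemma:
  fixes VA :: "'x set" and V :: "nat set" and lev :: "nat \<Rightarrow> nat"
  assumes st0: "partial_steiner k t V E" and t: "t > 0" and r: "r > 0"
    and A: "finite VA" "\<forall>e\<in>EA. e \<subseteq> VA"
    and ls: "\<forall>l\<in>set ls. inj_on l VA"
  shows "\<exists>V' E' lev'. partial_steiner k t V' E' \<and> (\<forall>\<chi> :: nat set \<Rightarrow> nat. (\<forall>s. \<chi> s < r) \<longrightarrow>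
    (\<exists>\<phi>. strong t \<phi> V E V' E' \<and> (\<forall>v\<in>V. lev' (\<phi> v) = lev v) \<and>
      (\<forall>l\<in>set ls. \<exists>c. \<forall>\<eta>. strong t \<eta> VA EA V E \<and> (\<forall>x\<in>VA. lev (\<eta> x) = l x) \<longrightarrow> \<chi> (\<phi> ` \<eta> ` VA) = c)))"
  using ls
proof (induction ls)
  case Nil
  show ?case
    by (rule exI[of _ V], rule exI[of _ E], rule exI[of _ lev], intro conjI allI impI, rule st0,
        rule exI[of _ id], intro conjI strong_id) simp_all
next
  case (Cons l ls)
  have "\<forall>l'\<in>set ls. inj_on l' VA" using Cons.prems by simp
  from Cons.IH[OF this] obtain V1 E1 lev1 where st1: "partial_steiner k t V1 E1"
    and 1: "\<And>\<chi> :: nat set \<Rightarrow> nat. \<forall>s. \<chi> s < r \<Longrightarrow>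
      \<exists>\<phi>. strong t \<phi> V E V1 E1 \<and> (\<forall>v\<in>V. lev1 (\<phi> v) = lev v) \<and>
      (\<forall>l\<in>set ls. \<exists>c. \<forall>\<eta>. strong t \<eta> VA EA V E \<and> (\<forall>x\<in>VA. lev (\<eta> x) = l x) \<longrightarrow> \<chi> (\<phi> ` \<eta> ` VA) = c)"
    by blast
  \<comment> \<open>Extensional functions keep the set of letters finite.\<close>
  define H where "H = {\<eta> \<in> VA \<rightarrow>\<^sub>E V1. strong t \<eta> VA EA V1 E1 \<and> (\<forall>x\<in>VA. lev1 (\<eta> x) = l x)}"
  have "finite (VA \<rightarrow>\<^sub>E V1)" using A(1) partial_steinerD(1)[OF st1] by (intro finite_PiE)
  then have "finite H" by (rule rev_finite_subset) (auto simp: H_def)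
  then obtain h M where H: "H = h ` {i. i < (M::nat)}" using finite_imp_nat_seg_image_inj_on by metis
  have hH: "strong t (h i) VA EA V1 E1 \<and> (\<forall>x\<in>VA. lev1 (h i x) = l x)" if "i < M" for i
  proof -
    have "h i \<in> H" using H that by auto
    then show ?thesis by (simp add: H_def)
  qed
  interpret partite k t V1 E1 lev1 VA EA l h M
  proof
    show "inj_on l VA" using Cons.prems by simp
    show "lev1 (h m x) = l x" if "m < M" "x \<in> VA" for m x using hH that by blast
    show "strong t (h m) VA EA V1 E1" if "m < M" for m using hH that by blast
  qed (use st1 t A in auto)
  from partite_lemma[OF r] obtain V2 E2 lev2 where st2: "partial_steiner k t V2 E2"
    and 2: "\<And>\<chi> :: nat set \<Rightarrow> nat. \<forall>s. \<chi> s < r \<Longrightarrow>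
      \<exists>\<phi>. strong t \<phi> V1 E1 V2 E2 \<and> (\<forall>v\<in>V1. lev2 (\<phi> v) = lev1 v) \<and> (\<exists>c. \<forall>m<M. \<chi> (\<phi> ` h m ` VA) = c)"
    by blast
  show ?case
  proof (rule exI[of _ V2], rule exI[of _ E2], rule exI[of _ lev2], intro conjI st2 allI impI)
    fix \<chi> :: "nat set \<Rightarrow> nat" assume \<chi>: "\<forall>s. \<chi> s < r"
    obtain \<phi>2 c2 where \<phi>2: "strong t \<phi>2 V1 E1 V2 E2" "\<And>v. v \<in> V1 \<Longrightarrow> lev2 (\<phi>2 v) = lev1 v"
      "\<And>m. m < M \<Longrightarrow> \<chi> (\<phi>2 ` h m ` VA) = c2"
      using 2[OF \<chi>] by blast
    have "\<forall>s. \<chi> (\<phi>2 ` s) < r" using \<chi> by blast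
    from 1[OF this] obtain \<phi>1 where \<phi>1: "strong t \<phi>1 V E V1 E1" "\<And>v. v \<in> V \<Longrightarrow> lev1 (\<phi>1 v) = lev v"
      "\<And>l. l \<in> set ls \<Longrightarrow> \<exists>c. \<forall>\<eta>. strong t \<eta> VA EA V E \<and> (\<forall>x\<in>VA. lev (\<eta> x) = l x) \<longrightarrow> \<chi> (\<phi>2 ` \<phi>1 ` \<eta> ` VA) = c"
      by blast
    have V1: "\<phi>1 v \<in> V1" if "v \<in> V" for v using \<phi>1(1) that unfolding strong_def by blast
    have im: "(\<phi>2 \<circ> \<phi>1) ` s = \<phi>2 ` \<phi>1 ` s" for s by (simp add: image_image)
    have "\<chi> (\<phi>2 ` \<phi>1 ` \<eta> ` VA) = c2" if \<eta>: "strong t \<eta> VA EA V E" "\<forall>x\<in>VA. lev (\<eta> x) = l x" for \<eta>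
    proof -
      \<comment> \<open>Restriction to \<open>VA\<close> makes \<open>\<phi>1 \<circ> \<eta>\<close>
        one of the enumerated letters without changing the copy.\<close>
      let ?g = "restrict (\<phi>1 \<circ> \<eta>) VA"
      have "strong t (\<phi>1 \<circ> \<eta>) VA EA V1 E1"
        using strong_comp[OF \<eta>(1) \<phi>1(1)] partial_steinerD(2)[OF st0] partial_steinerD(3)[OF st1] by blast
      then have "strong t ?g VA EA V1 E1" by (rule strong_cong) (auto simp: A(2))
      moreover have V: "\<eta> x \<in> V" if "x \<in> VA" for x using \<eta>(1) that unfolding strong_def by blast
      ultimately have "?g \<in> H" using \<eta>(2) \<phi>1(2) V1 by (auto simp: H_def)
      then obtain i where i: "i < M" "?g = h i" using H by auto
      have "h i ` VA = \<phi>1 ` \<eta> ` VA" unfolding i(2)[symmetric] by (simp add: image_image)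
      then show ?thesis using \<phi>2(3)[OF i(1)] by simp
    qed
    moreover have "strong t (\<phi>2 \<circ> \<phi>1) V E V2 E2"
      using strong_comp[OF \<phi>1(1) \<phi>2(1)] partial_steinerD(2)[OF st1] partial_steinerD(3)[OF st2] by blast
    moreover have "lev2 ((\<phi>2 \<circ> \<phi>1) v) = lev v" if "v \<in> V" for v
      using \<phi>1(2)[OF that] \<phi>2(2)[OF V1[OF that]] by simp
    ultimately show "\<exists>\<phi>. strong t \<phi> V E V2 E2 \<and> (\<forall>v\<in>V. lev2 (\<phi> v) = lev v) \<and>
      (\<forall>l'\<in>set (l # ls). \<exists>c. \<forall>\<eta>. strong t \<eta> VA EA V E \<and> (\<forall>x\<in>VA. lev (\<eta> x) = l' x) \<longrightarrow> \<chi> (\<phi> ` \<eta> ` VA) = c)"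
      using \<phi>1(3) by (intro exI[of _ "\<phi>2 \<circ> \<phi>1"]) (auto simp only: im set_simps)
  qed
qed

section \<open>The Ramsey theorem for systems on initial segments of the naturals\<close>

lemma nth_sorted_list_of_image:
  fixes f :: "nat \<Rightarrow> nat"
  assumes "strict_mono_on {..<a} f" "x < a"
  shows "sorted_list_of_set (f ` {..<a}) ! x = f x"
proof -
  have "sorted (map f [0..<a])" "distinct (map f [0..<a])"
    using assms(1) strict_mono_on_imp_inj_on[OF assms(1)]
    by (auto simp: sorted_iff_nth_mono distinct_map atLeast0LessThan monotone_on_def le_less)
  then have "sorted_list_of_set (f ` {..<a}) = map f [0..<a]"
    by (intro sorted_distinct_set_unique) (auto simp: atLeast0LessThan)
  then show ?thesis using assms(2) by simp
qed

lemma strict_mono_on_nth_sorted_list: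
  fixes Y :: "nat set"
  assumes "finite Y"
  shows "strict_mono_on {..<card Y} ((!) (sorted_list_of_set Y))"
proof (rule strict_mono_onI)
  fix i j assume "i \<in> {..<card Y}" "j \<in> {..<card Y}" "i < j"
  then show "sorted_list_of_set Y ! i < sorted_list_of_set Y ! j"
    using sorted_wrt_nth_less[OF strict_sorted_list_of_set] by simp
qed

text \<open>The initial system is a disjoint union of copies of \<open>B\<close>, one for each
  \<open>b\<close>-subset \<open>Y\<close> of \<open>{..<N}\<close>, with levels enumerating
  \<open>Y\<close>. Once the colour of a copy of \<open>A\<close> depends only on its set
  \<open>X\<close> of levels, the finite Ramsey theorem selects a \<open>Y\<close> on which it is
  constant.\<close>

theorem ordered_steiner_ramsey:
  fixes k t r a b :: nat
  assumes t: "t > 0" and r: "r > 0"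
    and A: "partial_steiner k t {..<a} EA" and B: "partial_steiner k t {..<b} EB"
  shows "\<exists>V E lev. partial_steiner k t (V :: nat set) E \<and> (\<forall>\<chi> :: nat set \<Rightarrow> nat. (\<forall>s. \<chi> s < r) \<longrightarrow>
    (\<exists>\<beta> c. strong t \<beta> {..<b} EB V E \<and> strict_mono_on {..<b} (\<lambda>j. lev (\<beta> j) :: nat) \<and>
      (\<forall>\<eta>. strong t \<eta> {..<a} EA {..<b} EB \<and> strict_mono_on {..<a} \<eta> \<longrightarrow> \<chi> (\<beta> ` \<eta> ` {..<a}) = c)))"
proof -
  obtain N :: nat where N: "partn_lst {..<N} (replicate r b) a" using ramsey_full by blast
  \<comment> \<open>A vertex is coded by the enumeration of \<open>Y\<close> and an index: different
    \<open>Y\<close> give disjoint copies, and the level is the indexed entry.\<close>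
  define p where "p Y j = to_nat (sorted_list_of_set Y :: nat list, j :: nat)" for Y j
  define lev where "lev z = (case from_nat z of (ys, j) \<Rightarrow> (ys :: nat list) ! (j :: nat))" for z
  define V where "V = (\<Union>Y\<in>[{..<N}]\<^bsup>b\<^esup>. p Y ` {..<b})"
  define E where "E = (\<Union>Y\<in>[{..<N}]\<^bsup>b\<^esup>. (`) (p Y) ` EB)"
  note stB = partial_steinerD[OF B]
  have lev_p: "lev (p Y j) = sorted_list_of_set Y ! j" for Y j by (simp add: lev_def p_def)
  have inj_p: "inj (p Y)" for Y by (auto simp: inj_def p_def)
  have p_disj: "p Y ` S \<inter> p Z ` T = {}" if "Y \<noteq> Z" "Y \<in> [{..<N}]\<^bsup>b\<^esup>" "Z \<in> [{..<N}]\<^bsup>b\<^esup>" for Y Z S T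
  proof -
    have "finite Y" "finite Z" using that by (auto simp: nsets_def)
    then have "sorted_list_of_set Y \<noteq> sorted_list_of_set Z"
      using that(1) by (metis sorted_list_of_set.set_sorted_key_list_of_set)
    then show ?thesis by (auto simp: p_def)
  qed
  have steiner: "partial_steiner k t V E"
    unfolding partial_steiner_def
  proof (intro conjI ballI impI)
    show "finite V" by (simp add: V_def finite_imp_finite_nsets)
    show "E \<subseteq> [V]\<^bsup>k\<^esup>"
    proof
      fix d assume "d \<in> E"
      then obtain Y e where Y: "Y \<in> [{..<N}]\<^bsup>b\<^esup>" "e \<in> EB" "d = p Y ` e" by (auto simp: E_def)
      then have "card d = k" "finite d"
        using stB(3,4)[OF Y(2)] inj_on_subset[OF inj_p subset_UNIV] by (auto simp: card_image)
      then show "d \<in> [V]\<^bsup>k\<^esup>" using Y stB(2)[OF Y(2)] unfolding nsets_def V_def by blast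
    qed
    fix d d' assume "d \<in> E" "d' \<in> E" and card_d: "t \<le> card (d \<inter> d')"
    then obtain Y e Z e' where d: "Y \<in> [{..<N}]\<^bsup>b\<^esup>" "e \<in> EB" "d = p Y ` e"
      "Z \<in> [{..<N}]\<^bsup>b\<^esup>" "e' \<in> EB" "d' = p Z ` e'" by (auto simp: E_def)
    then have "Y = Z" using p_disj[of Y Z e e'] card_d t by (metis card.empty not_less)
    then have "card (e \<inter> e') \<ge> t"
      using card_d d image_Int[OF inj_p[of Y], of e e'] card_image[OF inj_on_subset[OF inj_p subset_UNIV]] by metis
    then show "d = d'" using stB(5) d \<open>Y = Z\<close> by blast
  qed
  have strong_p: "strong t (p Y) {..<b} EB V E" if Y: "Y \<in> [{..<N}]\<^bsup>b\<^esup>" for Y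
  proof -
    have "absorbs t (p Y ` {..<b}) ((`) (p Y) ` EB) E"
      unfolding absorbs_def
    proof (intro ballI impI)
      fix d assume "d \<in> E" and card_d: "t \<le> card (d \<inter> p Y ` {..<b})"
      then obtain Z e where Z: "Z \<in> [{..<N}]\<^bsup>b\<^esup>" "e \<in> EB" "d = p Z ` e" by (auto simp: E_def)
      then have "Z = Y" using p_disj[of Z Y e "{..<b}"] card_d t Y by (metis card.empty not_less)
      then show "d \<in> (`) (p Y) ` EB" using Z by blast
    qed
    then show ?thesis using Y inj_on_subset[OF inj_p subset_UNIV] unfolding strong_def V_def E_def by blast
  qed
  obtain Xs where Xs: "set Xs = [{..<N}]\<^bsup>a\<^esup>"
    using finite_list[OF finite_imp_finite_nsets[of "{..<N}" a]] by auto
  let ?l = "\<lambda>X j. sorted_list_of_set X ! j"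
  have edges_A: "\<forall>e\<in>EA. e \<subseteq> {..<a}" using partial_steinerD(2)[OF A] by blast
  have inj_l: "\<forall>l\<in>set (map ?l Xs). inj_on l {..<a}"
    using strict_mono_on_imp_inj_on[OF strict_mono_on_nth_sorted_list] Xs by (auto simp: nsets_def)
  from iterated_partite_lemma[where EA = EA and ls = "map ?l Xs" and lev = lev,
      OF steiner t r finite_lessThan edges_A inj_l]
  obtain V' E' lev' where st': "partial_steiner k t V' E'"
    and \<chi>: "\<forall>\<chi> :: nat set \<Rightarrow> nat. (\<forall>s. \<chi> s < r) \<longrightarrow>
      (\<exists>\<phi>. strong t \<phi> V E V' E' \<and> (\<forall>v\<in>V. lev' (\<phi> v) = lev v) \<and>
      (\<forall>l\<in>set (map ?l Xs). \<exists>c. \<forall>\<eta>. strong t \<eta> {..<a} EA V E \<and> (\<forall>x\<in>{..<a}. lev (\<eta> x) = l x) \<longrightarrow>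
        \<chi> (\<phi> ` \<eta> ` {..<a}) = c))"
    by (elim exE conjE) (rule that)
  show ?thesis
  proof (rule exI[of _ V'], rule exI[of _ E'], rule exI[of _ lev'], intro conjI st' allI impI)
    fix \<chi> :: "nat set \<Rightarrow> nat" assume r': "\<forall>s. \<chi> s < r"
    obtain \<phi> where \<phi>: "strong t \<phi> V E V' E'" "\<And>v. v \<in> V \<Longrightarrow> lev' (\<phi> v) = lev v"
      "\<And>X. X \<in> [{..<N}]\<^bsup>a\<^esup> \<Longrightarrow> \<exists>c. \<forall>\<eta>. strong t \<eta> {..<a} EA V E \<and> (\<forall>x\<in>{..<a}. lev (\<eta> x) = ?l X x) \<longrightarrow>
        \<chi> (\<phi> ` \<eta> ` {..<a}) = c"
      using spec[OF \<chi>, of \<chi>, THEN mp, OF r'] unfolding set_map Xs by blast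
    \<comment> \<open>If no copy lies on the levels \<open>X\<close>, any colour below
      \<open>r\<close> is admissible, and \<open>r > 0\<close> supplies one.\<close>
    have "\<exists>c<r. \<forall>\<eta>. strong t \<eta> {..<a} EA V E \<and> (\<forall>x\<in>{..<a}. lev (\<eta> x) = ?l X x) \<longrightarrow>
        \<chi> (\<phi> ` \<eta> ` {..<a}) = c" if X: "X \<in> [{..<N}]\<^bsup>a\<^esup>" for X
      using \<phi>(3)[OF X] r r' by metis
    then obtain g where g: "\<And>X. X \<in> [{..<N}]\<^bsup>a\<^esup> \<Longrightarrow> g X < r"
      "\<And>X \<eta>. X \<in> [{..<N}]\<^bsup>a\<^esup> \<Longrightarrow> strong t \<eta> {..<a} EA V E \<Longrightarrow> \<forall>x\<in>{..<a}. lev (\<eta> x) = ?l X x \<Longrightarrow>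
        \<chi> (\<phi> ` \<eta> ` {..<a}) = g X"
      by metis
    have "g \<in> [{..<N}]\<^bsup>a\<^esup> \<rightarrow> {..<r}" using g(1) by auto
    from partn_lstE[OF N this] obtain c Y where cY: "c < r" "Y \<in> [{..<N}]\<^bsup>b\<^esup>" "g ` [Y]\<^bsup>a\<^esup> \<subseteq> {c}"
      by auto
    have Y: "finite Y" "card Y = b" "Y \<subseteq> {..<N}" using cY(2) by (auto simp: nsets_def)
    have pV: "p Y j \<in> V" if "j < b" for j using cY(2) that by (auto simp: V_def)
    have "strict_mono_on {..<b} (\<lambda>j. lev' ((\<phi> \<circ> p Y) j))"
      using strict_mono_on_nth_sorted_list[OF Y(1)] \<phi>(2) pV unfolding Y(2)
      by (simp add: monotone_on_def lev_p)
    moreover have "strong t (\<phi> \<circ> p Y) {..<b} EB V' E'"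
      using strong_comp[OF strong_p[OF cY(2)] \<phi>(1)] partial_steinerD(2)[OF steiner] partial_steinerD(3)[OF st'] by blast
    moreover have "\<chi> ((\<phi> \<circ> p Y) ` \<eta> ` {..<a}) = c"
      if \<eta>: "strong t \<eta> {..<a} EA {..<b} EB" "strict_mono_on {..<a} \<eta>" for \<eta>
    proof -
      \<comment> \<open>The levels of the copy \<open>p Y \<circ> \<eta>\<close>. They increase with
        \<open>x\<close>, hence are the enumeration of \<open>?X\<close> to which \<open>g\<close>
        refers.\<close>
      let ?f = "\<lambda>x. ?l Y (\<eta> x)"
      let ?X = "?f ` {..<a}"
      have \<eta>b: "\<eta> x < b" if "x < a" for x using \<eta>(1) that unfolding strong_def by auto
      then have mono: "strict_mono_on {..<a} ?f"
        using strict_mono_on_nth_sorted_list[OF Y(1)] \<eta>(2) unfolding Y(2) by (auto simp: monotone_on_def)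
      have "?l Y j \<in> Y" if "j < b" for j
        using nth_mem[of j "sorted_list_of_set Y"] that Y(1,2) by simp
      then have "?X \<subseteq> Y" using \<eta>b by auto
      moreover have "card ?X = a" using card_image[OF strict_mono_on_imp_inj_on[OF mono]] by simp
      ultimately have X: "?X \<in> [Y]\<^bsup>a\<^esup>" "?X \<in> [{..<N}]\<^bsup>a\<^esup>" using Y by (auto simp: nsets_def)
      have "strong t (p Y \<circ> \<eta>) {..<a} EA V E"
        using strong_comp[OF \<eta>(1) strong_p[OF cY(2)]] stB(2) partial_steinerD(3)[OF steiner] by blast
      moreover have "\<forall>x\<in>{..<a}. lev ((p Y \<circ> \<eta>) x) = ?l ?X x"
        using nth_sorted_list_of_image[OF mono] by (simp add: lev_p)
      ultimately have "\<chi> (\<phi> ` (p Y \<circ> \<eta>) ` {..<a}) = g ?X" by (rule g(2)[OF X(2)])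
      moreover have "g ?X = c" using cY(3) X(1) by blast
      ultimately show ?thesis by (simp add: image_image)
    qed
    ultimately show "\<exists>\<beta> c. strong t \<beta> {..<b} EB V' E' \<and> strict_mono_on {..<b} (\<lambda>j. lev' (\<beta> j)) \<and>
      (\<forall>\<eta>. strong t \<eta> {..<a} EA {..<b} EB \<and> strict_mono_on {..<a} \<eta> \<longrightarrow> \<chi> (\<beta> ` \<eta> ` {..<a}) = c)"
      by blast
  qed
qed

section \<open>Structures over an arbitrary vertex type\<close>

lemma linear_orderD:
  assumes "linear_order_on X R"
  shows "(x, y) \<in> R \<Longrightarrow> x \<in> X \<and> y \<in> X" "x \<in> X \<Longrightarrow> (x, x) \<in> R"
    "(x, y) \<in> R \<Longrightarrow> (y, z) \<in> R \<Longrightarrow> (x, z) \<in> R" "(x, y) \<in> R \<Longrightarrow> (y, x) \<in> R \<Longrightarrow> x = y"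
    "x \<in> X \<Longrightarrow> y \<in> X \<Longrightarrow> (x, y) \<in> R \<or> (y, x) \<in> R"
proof -
  have R: "R \<subseteq> X \<times> X" "\<forall>x\<in>X. (x, x) \<in> R" "trans R" "antisym R" "total_on X R"
    using assms unfolding order_on_defs refl_on_def by blast+
  show "(x, y) \<in> R \<Longrightarrow> x \<in> X \<and> y \<in> X" using R(1) by blast
  show refl: "x \<in> X \<Longrightarrow> (x, x) \<in> R" for x using R(2) by blast
  show "(x, y) \<in> R \<Longrightarrow> (y, z) \<in> R \<Longrightarrow> (x, z) \<in> R" using R(3) by (rule transD)
  show "(x, y) \<in> R \<Longrightarrow> (y, x) \<in> R \<Longrightarrow> x = y" using R(4) by (rule antisymD)
  show "x \<in> X \<Longrightarrow> y \<in> X \<Longrightarrow> (x, y) \<in> R \<or> (y, x) \<in> R"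
    using R(5) refl unfolding total_on_def by (cases "x = y") auto
qed

lemma card_down_set_less:
  assumes R: "linear_order_on X R" and "finite S" "S \<subseteq> X" "x \<in> S" "y \<in> S" "(x, y) \<in> R" "x \<noteq> y"
  shows "card {z \<in> S. (z, x) \<in> R} < card {z \<in> S. (z, y) \<in> R}"
proof (rule psubset_card_mono)
  show "{z \<in> S. (z, x) \<in> R} \<subset> {z \<in> S. (z, y) \<in> R}"
    using assms linear_orderD[OF R] by blast
qed (use assms in simp)

lemma finite_linear_order_enum:
  assumes R: "linear_order_on X R" and fin: "finite X"
  obtains \<alpha> where "bij_betw \<alpha> {..<card X} X" "\<And>i j. i < card X \<Longrightarrow> j < card X \<Longrightarrow> (\<alpha> i, \<alpha> j) \<in> R \<longleftrightarrow> i \<le> j"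
proof -
  \<comment> \<open>The down set contains \<open>x\<close> itself; subtracting one makes ranks start
    at \<open>0\<close>.\<close>
  define rank where "rank x = card {z \<in> X. (z, x) \<in> R} - 1" for x
  have pos: "card {z \<in> X. (z, x) \<in> R} > 0" if "x \<in> X" for x
    using that fin linear_orderD(2)[OF R] by (auto simp: card_gt_0_iff)
  have less: "rank x < rank y" if "(x, y) \<in> R" "x \<noteq> y" for x y
    using card_down_set_less[OF R fin order_refl _ _ that] pos linear_orderD(1)[OF R that(1)]
    by (fastforce simp: rank_def)
  have iff: "rank x \<le> rank y \<longleftrightarrow> (x, y) \<in> R" if "x \<in> X" "y \<in> X" for x y
    using less linear_orderD(2,5)[OF R] that by (metis less_le_not_le linorder_not_less order_refl)
  have inj: "inj_on rank X"
    using iff linear_orderD(4)[OF R] by (metis inj_onI order_refl)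
  have "rank x < card X" if "x \<in> X" for x
    using card_mono[OF fin, of "{z \<in> X. (z, x) \<in> R}"] pos[OF that] unfolding rank_def by fastforce
  then have "rank ` X = {..<card X}"
    using card_image[OF inj] by (intro card_subset_eq) auto
  then have bij: "bij_betw rank X {..<card X}" using inj by (simp add: bij_betw_def)
  have rank_inv: "rank (inv_into X rank i) = i" "inv_into X rank i \<in> X" if "i < card X" for i
    using that bij by (auto simp: bij_betw_def f_inv_into_f inv_into_into)
  show ?thesis
    by (rule that[OF bij_betw_inv_into[OF bij]]) (use iff rank_inv in metis)
qed

text \<open>The position of a vertex in the source equals the position of its image, so the image
  set determines the map. This is what lets a colouring of vertex sets represent a partition of
  copies.\<close>

lemma mono_inj_unique:
  assumes A: "linear_order_on (verts A) (ord A)" "finite (verts A)" and C: "linear_order_on (verts C) (ord C)"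
    and f: "mono_inj f A C" and g: "mono_inj g A C" and im: "f ` verts A = g ` verts A" and x: "x \<in> verts A"
  shows "f x = g x"
proof -
  let ?D = "\<lambda>y. {w \<in> f ` verts A. (w, y) \<in> ord C}"
  have D: "card {w \<in> h ` verts A. (w, h x) \<in> ord C} = card {z \<in> verts A. (z, x) \<in> ord A}" if h: "mono_inj h A C" for h
  proof -
    have inj: "inj_on h (verts A)" and mono: "\<And>z z'. (z, z') \<in> ord A \<Longrightarrow> (h z, h z') \<in> ord C"
      using h linear_orderD(1)[OF A(1)] by (auto simp: mono_inj_def monotone_on_def)
    have "(h z, h x) \<in> ord C \<longleftrightarrow> (z, x) \<in> ord A" if "z \<in> verts A" for z
      using mono linear_orderD(4)[OF C] linear_orderD(2,5)[OF A(1)] inj that x by (metis inj_onD)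
    then have "{w \<in> h ` verts A. (w, h x) \<in> ord C} = h ` {z \<in> verts A. (z, x) \<in> ord A}" by auto
    then show ?thesis using inj by (simp add: card_image inj_on_subset)
  qed
  have eq: "card (?D (f x)) = card (?D (g x))" using D[OF f] D[OF g] im by simp
  have fin: "finite (f ` verts A)" and sub: "f ` verts A \<subseteq> verts C"
    and mem: "f x \<in> f ` verts A" "g x \<in> f ` verts A"
    using A(2) f x im unfolding mono_inj_def by blast+
  show ?thesis
  proof (rule ccontr)
    assume ne: "f x \<noteq> g x"
    have "(f x, g x) \<in> ord C \<or> (g x, f x) \<in> ord C"
      using linear_orderD(5)[OF C] mem sub by blast
    then show False
      using card_down_set_less[OF C fin sub mem _ ne]
        card_down_set_less[OF C fin sub mem(2,1) _ ne[symmetric]] eq by auto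
  qed
qed

lemma linear_order_on_map:
  assumes R: "linear_order_on X R" and inj: "inj_on f X"
  shows "linear_order_on (f ` X) (map_prod f f ` R)"
proof -
  have RX: "R \<subseteq> X \<times> X" using R by (simp add: order_on_defs)
  have iff: "(f x, f y) \<in> map_prod f f ` R \<longleftrightarrow> (x, y) \<in> R" if "x \<in> X" "y \<in> X" for x y
  proof
    assume "(f x, f y) \<in> map_prod f f ` R"
    then obtain x' y' where "(x', y') \<in> R" "f x = f x'" "f y = f y'" by auto
    then show "(x, y) \<in> R" using RX that inj by (metis inj_onD mem_Sigma_iff subsetD)
  qed force
  have sub: "map_prod f f ` R \<subseteq> f ` X \<times> f ` X" using RX by auto
  show ?thesis
    unfolding order_on_defs
  proof (intro conjI sub)
    have mem: "u \<in> f ` X" "v \<in> f ` X" if "(u, v) \<in> map_prod f f ` R" for u v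
      using subsetD[OF sub that] by simp_all
    show "refl_on (f ` X) (map_prod f f ` R)"
      unfolding refl_on_def using iff linear_orderD(2)[OF R] by blast
    show "trans (map_prod f f ` R)"
    proof (rule transI)
      fix u v w assume uv: "(u, v) \<in> map_prod f f ` R" and vw: "(v, w) \<in> map_prod f f ` R"
      obtain x y z where *: "x \<in> X" "y \<in> X" "z \<in> X" "u = f x" "v = f y" "w = f z"
        using mem[OF uv] mem[OF vw] by blast
      have "(x, y) \<in> R" "(y, z) \<in> R" using uv vw iff[OF *(1,2)] iff[OF *(2,3)] *(4-6) by simp_all
      then have "(x, z) \<in> R" by (rule linear_orderD(3)[OF R])
      then show "(u, w) \<in> map_prod f f ` R" using iff[OF *(1,3)] *(4,6) by simp
    qed
    show "antisym (map_prod f f ` R)"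
    proof (rule antisymI)
      fix u v assume uv: "(u, v) \<in> map_prod f f ` R" "(v, u) \<in> map_prod f f ` R"
      obtain x y where *: "x \<in> X" "y \<in> X" "u = f x" "v = f y" using mem[OF uv(1)] by blast
      have "(x, y) \<in> R" "(y, x) \<in> R" using uv iff[OF *(1,2)] iff[OF *(2,1)] *(3,4) by simp_all
      then have "x = y" by (rule linear_orderD(4)[OF R])
      then show "u = v" using *(3,4) by simp
    qed
    show "total_on (f ` X) (map_prod f f ` R)"
      unfolding total_on_def
    proof (intro ballI impI)
      fix u v assume "u \<in> f ` X" "v \<in> f ` X"
      then obtain x y where *: "x \<in> X" "y \<in> X" "u = f x" "v = f y" by blast
      then show "(u, v) \<in> map_prod f f ` R \<or> (v, u) \<in> map_prod f f ` R"
        using linear_orderD(5)[OF R *(1,2)] iff[OF *(1,2)] iff[OF *(2,1)] by simp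
    qed
  qed
qed

lemma partial_steiner_image:
  assumes "partial_steiner k t V E" "inj_on f V"
  shows "partial_steiner k t (f ` V) ((`) f ` E)"
  unfolding partial_steiner_def
proof (intro conjI ballI impI)
  note st = partial_steinerD[OF assms(1)]
  show "finite (f ` V)" using st(1) by simp
  show "(`) f ` E \<subseteq> [f ` V]\<^bsup>k\<^esup>"
    using st(2,3,4) assms(2) by (auto simp: nsets_def card_image inj_on_subset)
  fix d d' assume d: "d \<in> (`) f ` E" "d' \<in> (`) f ` E" "card (d \<inter> d') \<ge> t"
  then obtain e e' where e: "e \<in> E" "e' \<in> E" "d = f ` e" "d' = f ` e'" by blast
  have "d \<inter> d' = f ` (e \<inter> e')" using e st(2) assms(2) by (metis inj_on_image_Int)
  then have "card (e \<inter> e') \<ge> t"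
    using d(3) card_image_le[of "e \<inter> e'" f] st(3)[OF e(1)] by fastforce
  then show "d = d'" using st(5) e by blast
qed

lemma strong_image: "inj_on f V \<Longrightarrow> strong t f V E (f ` V) ((`) f ` E)"
  unfolding strong_def absorbs_def by (intro conjI order_refl ballI impI)

lemma strong_inv_into:
  assumes "inj_on f V" "\<And>e. e \<in> E \<Longrightarrow> e \<subseteq> V"
  shows "strong t (inv_into V f) (f ` V) ((`) f ` E) V E"
proof -
  have im: "inv_into V f ` f ` S = S" if "S \<subseteq> V" for S
    using assms(1) that by (rule inv_into_image_cancel)
  then have E: "(`) (inv_into V f) ` (`) f ` E = E"
    using assms(2) by (force simp: image_iff)
  show ?thesis
    unfolding strong_def E using im[OF order_refl] inj_on_inv_into[of "f ` V" f V] by (simp add: absorbs_def)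
qed

lemma strong_image_id: "strong t f V E V' E' \<Longrightarrow> strong t id (f ` V) ((`) f ` E) V' E'"
  unfolding strong_def image_id id_apply by (intro conjI inj_on_id) simp_all

section \<open>The given definitions in terms of intersections with edges\<close>

lemma steiner_systems_iff:
  "G \<in> steiner_systems k t \<longleftrightarrow> linear_order_on (verts G) (ord G) \<and> partial_steiner k t (verts G) (edges G)"
proof (cases "finite (verts G) \<and> edges G \<subseteq> [verts G]\<^bsup>k\<^esup>")
  case True
  have iff: "(\<forall>s\<in>[verts G]\<^bsup>t\<^esup>. s \<subseteq> e \<and> s \<subseteq> e' \<longrightarrow> e = e') \<longleftrightarrow> (card (e \<inter> e') \<ge> t \<longrightarrow> e = e')"
    if "e \<in> edges G" "e' \<in> edges G" for e e'
  proof -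
    have e: "e \<subseteq> verts G" "finite (e \<inter> e')" using that True by (auto simp: nsets_def)
    have "card (e \<inter> e') \<ge> t \<longleftrightarrow> (\<exists>s\<in>[verts G]\<^bsup>t\<^esup>. s \<subseteq> e \<and> s \<subseteq> e')"
    proof
      assume "card (e \<inter> e') \<ge> t"
      then obtain s where "s \<subseteq> e \<inter> e'" "card s = t" "finite s" using obtain_subset_with_card_n by metis
      then show "\<exists>s\<in>[verts G]\<^bsup>t\<^esup>. s \<subseteq> e \<and> s \<subseteq> e'" using e by (auto simp: nsets_def)
    next
      assume "\<exists>s\<in>[verts G]\<^bsup>t\<^esup>. s \<subseteq> e \<and> s \<subseteq> e'"
      then show "card (e \<inter> e') \<ge> t" using e card_mono[OF e(2)] by (auto simp: nsets_def)
    qed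
    then show ?thesis by blast
  qed
  have "(\<forall>s\<in>[verts G]\<^bsup>t\<^esup>. \<forall>e\<in>edges G. \<forall>e'\<in>edges G. s \<subseteq> e \<and> s \<subseteq> e' \<longrightarrow> e = e') \<longleftrightarrow>
      (\<forall>e\<in>edges G. \<forall>e'\<in>edges G. \<forall>s\<in>[verts G]\<^bsup>t\<^esup>. s \<subseteq> e \<and> s \<subseteq> e' \<longrightarrow> e = e')"
    by blast
  also have "\<dots> \<longleftrightarrow> (\<forall>e\<in>edges G. \<forall>e'\<in>edges G. card (e \<inter> e') \<ge> t \<longrightarrow> e = e')"
    using iff by (intro ball_cong refl) auto
  finally show ?thesis using True unfolding steiner_systems_def partial_steiner_def by simp
qed (auto simp: steiner_systems_def partial_steiner_def)

text \<open>Containing a \<open>t\<close>-subset of the image means meeting the image in at least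
  \<open>t\<close> vertices. As \<open>t \<le> k\<close>, absorption applies to an edge that lies
  inside the image, and injectivity identifies its preimage; this yields reflection of
  edges.\<close>

lemma strong_embedding_iff:
  assumes "t \<le> k" "G \<in> steiner_systems k t" "G' \<in> steiner_systems k t"
  shows "strong_embedding k t h G G' \<longleftrightarrow>
    mono_inj h G G' \<and> strong t h (verts G) (edges G) (verts G') (edges G')"
proof -
  note st = partial_steinerD[OF assms(2)[unfolded steiner_systems_iff, THEN conjunct2]]
    and st' = partial_steinerD[OF assms(3)[unfolded steiner_systems_iff, THEN conjunct2]]
  have E: "edges G \<subseteq> [verts G]\<^bsup>k\<^esup>" using assms(2) by (simp add: steiner_systems_iff partial_steiner_def)
  have card_iff: "card (e' \<inter> h ` verts G) \<ge> t \<longleftrightarrow> (\<exists>s\<in>[h ` verts G]\<^bsup>t\<^esup>. s \<subseteq> e')" if "e' \<in> edges G'" for e'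
  proof
    assume "card (e' \<inter> h ` verts G) \<ge> t"
    then obtain s where "s \<subseteq> e' \<inter> h ` verts G" "card s = t" "finite s" using obtain_subset_with_card_n by metis
    then show "\<exists>s\<in>[h ` verts G]\<^bsup>t\<^esup>. s \<subseteq> e'" by (auto simp: nsets_def)
  next
    assume "\<exists>s\<in>[h ` verts G]\<^bsup>t\<^esup>. s \<subseteq> e'"
    then show "card (e' \<inter> h ` verts G) \<ge> t"
      using card_mono[of "e' \<inter> h ` verts G"] st'(3)[OF that] by (fastforce simp: nsets_def)
  qed
  have absorbs_iff: "absorbs t (h ` verts G) ((`) h ` edges G) (edges G') \<longleftrightarrow>
      (\<forall>s\<in>[h ` verts G]\<^bsup>t\<^esup>. \<forall>e'\<in>edges G'. s \<subseteq> e' \<longrightarrow> (\<exists>e\<in>edges G. e' = h ` e))"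
    using card_iff unfolding absorbs_def by (simp add: image_iff) blast
  have edges_iff: "(\<forall>e\<in>[verts G]\<^bsup>k\<^esup>. e \<in> edges G \<longleftrightarrow> h ` e \<in> edges G') \<longleftrightarrow> (`) h ` edges G \<subseteq> edges G'"
    if h: "inj_on h (verts G)" "absorbs t (h ` verts G) ((`) h ` edges G) (edges G')"
  proof
    assume "\<forall>e\<in>[verts G]\<^bsup>k\<^esup>. e \<in> edges G \<longleftrightarrow> h ` e \<in> edges G'"
    then show "(`) h ` edges G \<subseteq> edges G'" using E by blast
  next
    assume sub: "(`) h ` edges G \<subseteq> edges G'"
    show "\<forall>e\<in>[verts G]\<^bsup>k\<^esup>. e \<in> edges G \<longleftrightarrow> h ` e \<in> edges G'"
    proof (intro ballI iffI)
      fix e assume "e \<in> [verts G]\<^bsup>k\<^esup>" and he: "h ` e \<in> edges G'"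
      then have e: "e \<subseteq> verts G" "card e = k" by (auto simp: nsets_def)
      then have "h ` e \<inter> h ` verts G = h ` e" "card (h ` e) = k"
        using h(1) by (auto simp: card_image inj_on_subset)
      then have "h ` e \<in> (`) h ` edges G" using absorbsD[OF h(2) he] assms(1) by simp
      then obtain e1 where "e1 \<in> edges G" "h ` e = h ` e1" by blast
      then show "e \<in> edges G" using e st(2) h(1) by (metis inj_on_image_eq_iff)
    qed (use sub in blast)
  qed
  show ?thesis
  proof (cases "mono_inj h G G' \<and> absorbs t (h ` verts G) ((`) h ` edges G) (edges G')")
    case True
    then have "inj_on h (verts G)" "h ` verts G \<subseteq> verts G'" by (auto simp: mono_inj_def)
    then show ?thesis
      using True edges_iff absorbs_iff by (simp add: strong_embedding_def strong_def)
  next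
    case False
    then show ?thesis unfolding strong_embedding_def strong_def absorbs_iff[symmetric] by blast
  qed
qed

lemma steiner_image_in_systems:
  assumes "G \<in> steiner_systems k t" "inj_on f (verts G)"
  shows "steiner_image f G \<in> steiner_systems k t"
  using assms by (simp add: steiner_systems_iff steiner_image_def linear_order_on_map partial_steiner_image)

text \<open>An infinite \<open>'v\<close> has room for the system built on natural numbers. The
  enumerations of \<open>A\<close> and \<open>B\<close> translate between vertices and
  indices.\<close>

theorem steiner_systems_ramsey:
  assumes inf: "infinite (UNIV :: 'v set)" and t: "t > 0" and kt: "t \<le> k"
  shows "ramsey_class (steiner_systems k t :: 'v ord_hypergraph set) (strong_embedding k t) steiner_image"
  unfolding ramsey_class_def
proof (intro ballI allI impI)
  fix A B :: "'v ord_hypergraph" and r :: nat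
  assume A: "A \<in> steiner_systems k t" and B: "B \<in> steiner_systems k t" and r: "r > 0"
  note A' = A[unfolded steiner_systems_iff] and B' = B[unfolded steiner_systems_iff]
  note stA = partial_steinerD[OF A'[THEN conjunct2]] and stB = partial_steinerD[OF B'[THEN conjunct2]]
  define a b where "a = card (verts A)" and "b = card (verts B)"
  obtain \<alpha> where \<alpha>: "bij_betw \<alpha> {..<a} (verts A)" "\<And>i j. i < a \<Longrightarrow> j < a \<Longrightarrow> (\<alpha> i, \<alpha> j) \<in> ord A \<longleftrightarrow> i \<le> j"
    using finite_linear_order_enum[OF A'[THEN conjunct1] stA(1)] unfolding a_def by blast
  obtain \<gamma> where \<gamma>: "bij_betw \<gamma> {..<b} (verts B)" "\<And>i j. i < b \<Longrightarrow> j < b \<Longrightarrow> (\<gamma> i, \<gamma> j) \<in> ord B \<longleftrightarrow> i \<le> j"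
    using finite_linear_order_enum[OF B'[THEN conjunct1] stB(1)] unfolding b_def by blast
  define \<alpha>' \<gamma>' where "\<alpha>' = inv_into {..<a} \<alpha>" and "\<gamma>' = inv_into {..<b} \<gamma>"
  define EA EB where "EA = (`) \<alpha>' ` edges A" and "EB = (`) \<gamma>' ` edges B"
  have \<alpha>': "inj_on \<alpha>' (verts A)" "\<alpha>' ` verts A = {..<a}" "\<And>i. i < a \<Longrightarrow> \<alpha>' (\<alpha> i) = i" "\<And>x. x \<in> verts A \<Longrightarrow> \<alpha> (\<alpha>' x) = x"
    using bij_betw_inv_into[OF \<alpha>(1)] bij_betw_inv_into_left[OF \<alpha>(1)] bij_betw_inv_into_right[OF \<alpha>(1)]
    unfolding \<alpha>'_def bij_betw_def by auto
  have \<gamma>': "inj_on \<gamma>' (verts B)" "\<gamma>' ` verts B = {..<b}" "\<And>i. i < b \<Longrightarrow> \<gamma>' (\<gamma> i) = i" "\<And>x. x \<in> verts B \<Longrightarrow> \<gamma> (\<gamma>' x) = x"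
    using bij_betw_inv_into[OF \<gamma>(1)] bij_betw_inv_into_left[OF \<gamma>(1)] bij_betw_inv_into_right[OF \<gamma>(1)]
    unfolding \<gamma>'_def bij_betw_def by auto
  have st_a: "partial_steiner k t {..<a} EA" and st_b: "partial_steiner k t {..<b} EB"
    using partial_steiner_image[OF A'[THEN conjunct2] \<alpha>'(1)] partial_steiner_image[OF B'[THEN conjunct2] \<gamma>'(1)]
    unfolding EA_def EB_def \<alpha>'(2) \<gamma>'(2) .
  have \<alpha>A: "\<alpha> i \<in> verts A" if "i < a" for i using \<alpha>(1) that by (auto simp: bij_betw_def)
  have strong_\<alpha>: "strong t \<alpha> {..<a} EA (verts A) (edges A)"
  proof (rule strong_cong)
    show "strong t (inv_into (verts A) \<alpha>') {..<a} EA (verts A) (edges A)"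
      using strong_inv_into[OF \<alpha>'(1), of "edges A" t] stA(2) unfolding EA_def \<alpha>'(2) by blast
    show "\<alpha> i = inv_into (verts A) \<alpha>' i" if "i \<in> {..<a}" for i
      using inv_into_f_eq[OF \<alpha>'(1) \<alpha>A \<alpha>'(3)] that by simp
    show "e \<subseteq> {..<a}" if "e \<in> EA" for e using partial_steinerD(2)[OF st_a that] .
  qed
  have strong_\<gamma>': "strong t \<gamma>' (verts B) (edges B) {..<b} EB"
    using strong_image[OF \<gamma>'(1)] unfolding EB_def \<gamma>'(2) .
  obtain V E lev where VE: "partial_steiner k t (V :: nat set) E"
    and main: "\<And>\<chi> :: nat set \<Rightarrow> nat. \<forall>s. \<chi> s < r \<Longrightarrow>
      \<exists>\<beta> c. strong t \<beta> {..<b} EB V E \<and> strict_mono_on {..<b} (\<lambda>j. lev (\<beta> j) :: nat) \<and>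
      (\<forall>\<eta>. strong t \<eta> {..<a} EA {..<b} EB \<and> strict_mono_on {..<a} \<eta> \<longrightarrow> \<chi> (\<beta> ` \<eta> ` {..<a}) = c)"
    using ordered_steiner_ramsey[OF t r st_a st_b] by blast
  obtain \<iota> :: "nat \<Rightarrow> 'v" where \<iota>: "inj \<iota>" using infinite_countable_subset[OF inf] by blast
  \<comment> \<open>Distinct vertices may share a level, so ties are broken by the order of
    \<open>nat\<close>. Levels increase strictly along the copy \<open>\<beta>\<close> of
    \<open>B\<close>, which is what makes it monotone for this order.\<close>
  define leq where "leq = {(u, v). u \<in> V \<and> v \<in> V \<and> (lev u < lev v \<or> lev u = lev v \<and> u \<le> v)}"
  define C :: "'v ord_hypergraph" where "C = \<lparr>verts = \<iota> ` V, ord = map_prod \<iota> \<iota> ` leq, edges = (`) \<iota> ` E\<rparr>"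
  have \<iota>V: "inj_on \<iota> X" for X using \<iota> by (rule inj_on_subset) simp
  have "linear_order_on V leq"
    unfolding order_on_defs refl_on_def trans_def antisym_def total_on_def by (auto simp: leq_def)
  then have C: "C \<in> steiner_systems k t"
    using linear_order_on_map[OF _ \<iota>V] partial_steiner_image[OF VE \<iota>V] by (simp add: steiner_systems_iff C_def)
  note linA = A'[THEN conjunct1] and linB = B'[THEN conjunct1]
    and linC = C[unfolded steiner_systems_iff, THEN conjunct1]
  note stC = partial_steinerD[OF C[unfolded steiner_systems_iff, THEN conjunct2]]
  have strong_\<iota>: "strong t \<iota> V E (verts C) (edges C)"
    using strong_image[OF \<iota>V] by (simp add: C_def)
  show "\<exists>C\<in>steiner_systems k t. \<forall>P :: nat \<Rightarrow> 'v ord_hypergraph set.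
      disjoint_family_on P {..<r} \<and> (\<Union>i<r. P i) = copies (strong_embedding k t) steiner_image C A \<longrightarrow>
      (\<exists>B'\<in>copies (strong_embedding k t) steiner_image C B. \<exists>i<r. copies (strong_embedding k t) steiner_image B' A \<subseteq> P i)"
  proof (rule bexI[OF _ C], intro allI impI)
    fix P :: "nat \<Rightarrow> 'v ord_hypergraph set"
    assume "disjoint_family_on P {..<r} \<and> (\<Union>i<r. P i) = copies (strong_embedding k t) steiner_image C A"
    then have P: "(\<Union>i<r. P i) = copies (strong_embedding k t) steiner_image C A" by blast
    \<comment> \<open>A vertex set gets the index of some class containing a copy on it; sets
      carrying no copy get \<open>0\<close>, a legal colour since \<open>r > 0\<close>.\<close>
    define good where "good s i \<longleftrightarrow> i < r \<and> (\<exists>A'\<in>P i. verts A' = \<iota> ` s)" for s i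
    define \<chi> where "\<chi> s = (if \<exists>i. good s i then (SOME i. good s i) else 0)" for s
    have good: "good s (\<chi> s)" if "good s i" for s i
    proof -
      have "\<exists>i. good s i" using that by blast
      then show ?thesis unfolding \<chi>_def by (simp add: someI_ex)
    qed
    have "\<chi> s < r" for s
    proof (cases "\<exists>i. good s i")
      case True
      then show ?thesis using good unfolding good_def by blast
    qed (simp add: \<chi>_def r)
    then obtain \<beta> c where \<beta>: "strong t \<beta> {..<b} EB V E" "strict_mono_on {..<b} (\<lambda>j. lev (\<beta> j))"
      and mono: "\<And>\<eta>. strong t \<eta> {..<a} EA {..<b} EB \<Longrightarrow> strict_mono_on {..<a} \<eta> \<Longrightarrow> \<chi> (\<beta> ` \<eta> ` {..<a}) = c"
      using main[of \<chi>] by blast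
    define h where "h = \<iota> \<circ> (\<beta> \<circ> \<gamma>')"
    have "strong t (\<beta> \<circ> \<gamma>') (verts B) (edges B) V E"
      using strong_comp[OF strong_\<gamma>' \<beta>(1)] partial_steinerD(2)[OF st_b] partial_steinerD(3)[OF VE] by blast
    then have strong_h: "strong t h (verts B) (edges B) (verts C) (edges C)"
      unfolding h_def using strong_comp[OF _ strong_\<iota>] partial_steinerD(2)[OF VE] stC(3) by blast
    have h_inj: "inj_on h (verts B)" and h_verts: "h ` verts B \<subseteq> verts C" using strong_h by (auto simp: strong_def)
    have \<beta>V: "\<beta> j \<in> V" if "j < b" for j using \<beta>(1) that by (auto simp: strong_def)
    have \<gamma>'b: "\<gamma>' x < b" if "x \<in> verts B" for x using \<gamma>'(2) that by blast
    have \<gamma>'_mono: "\<gamma>' x \<le> \<gamma>' y \<and> x \<in> verts B \<and> y \<in> verts B" if xy: "(x, y) \<in> ord B" for x y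
    proof -
      have "x \<in> verts B" "y \<in> verts B" using linear_orderD(1)[OF linB xy] by auto
      then show ?thesis using \<gamma>(2)[OF \<gamma>'b \<gamma>'b] \<gamma>'(4) xy by metis
    qed
    have h_mono: "(h x, h y) \<in> ord C" if xy: "(x, y) \<in> ord B" for x y
    proof -
      have "\<gamma>' x = \<gamma>' y \<or> lev (\<beta> (\<gamma>' x)) < lev (\<beta> (\<gamma>' y))"
        using \<gamma>'_mono[OF xy] \<gamma>'b strict_mono_onD[OF \<beta>(2), of "\<gamma>' x" "\<gamma>' y"] by (cases "\<gamma>' x = \<gamma>' y") simp_all
      moreover have "\<beta> (\<gamma>' x) \<in> V" "\<beta> (\<gamma>' y) \<in> V" using \<gamma>'_mono[OF xy] \<gamma>'b \<beta>V by blast+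
      ultimately have "(\<beta> (\<gamma>' x), \<beta> (\<gamma>' y)) \<in> leq" by (auto simp: leq_def)
      then show ?thesis by (simp add: h_def C_def map_prod_imageI)
    qed
    define B1 where "B1 = steiner_image h B"
    have "mono_inj h B C"
      unfolding mono_inj_def monotone_on_def using h_inj h_verts h_mono by blast
    then have "strong_embedding k t h B C" using strong_h strong_embedding_iff[OF kt B C] by simp
    then have B1: "B1 \<in> copies (strong_embedding k t) steiner_image C B" by (auto simp: copies_def B1_def)
    have B1_sys: "B1 \<in> steiner_systems k t" unfolding B1_def using B h_inj by (rule steiner_image_in_systems)
    have in_P: "A1 \<in> P c \<and> c < r" if A1: "A1 \<in> copies (strong_embedding k t) steiner_image B1 A" for A1
    proof -
      from A1 obtain f where f: "strong_embedding k t f A B1" "A1 = steiner_image f A" by (auto simp: copies_def)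
      then have f': "mono_inj f A B1" "strong t f (verts A) (edges A) (h ` verts B) ((`) h ` edges B)"
        using strong_embedding_iff[OF kt A B1_sys] by (simp_all add: B1_def steiner_image_def)
      have f_mono: "(f x, f y) \<in> map_prod h h ` ord B" if "(x, y) \<in> ord A" for x y
        using f'(1) that linear_orderD(1)[OF linA that] by (simp add: mono_inj_def monotone_on_def B1_def steiner_image_def)
      have "strong t (id \<circ> f) (verts A) (edges A) (verts C) (edges C)"
        by (rule strong_comp[OF f'(2) strong_image_id[OF strong_h]]) (use stB(2) stC(3) in auto)
      moreover have f_C: "mono_inj f A C"
        unfolding mono_inj_def monotone_on_def
      proof (intro conjI ballI impI)
        show "f \<in> verts A \<rightarrow> verts C" using f'(2) h_verts unfolding strong_def by blast
        show "inj_on f (verts A)" using f'(2) by (simp add: strong_def)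
        fix x y assume "(x, y) \<in> ord A"
        then show "(f x, f y) \<in> ord C" using f_mono[of x y] h_mono by auto
      qed
      ultimately have "strong_embedding k t f A C" using strong_embedding_iff[OF kt A C] by simp
      then have "A1 \<in> (\<Union>i<r. P i)" unfolding P f(2) copies_def by blast
      then obtain i where i: "i < r" "A1 \<in> P i" by blast
      \<comment> \<open>The copy is pulled back through \<open>h\<close> to a map of
        \<open>A\<close> into \<open>B\<close>, and through the enumerations to a map of
        indices.\<close>
      define g where "g = inv_into (verts B) h \<circ> f"
      define \<eta> where "\<eta> = \<gamma>' \<circ> (g \<circ> \<alpha>)"
      have "strong t g (verts A) (edges A) (verts B) (edges B)"
        unfolding g_def by (rule strong_comp[OF f'(2) strong_inv_into[OF h_inj stB(2)]]) (use stB(2,3) in auto)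
      then have "strong t (g \<circ> \<alpha>) {..<a} EA (verts B) (edges B)"
        by (rule strong_comp[OF strong_\<alpha>]) (use stA(2) stB(3) in auto)
      then have strong_\<eta>: "strong t \<eta> {..<a} EA {..<b} EB"
        unfolding \<eta>_def by (rule strong_comp[OF _ strong_\<gamma>']) (use stB(2) partial_steinerD(3)[OF st_b] in auto)
      have hg: "h (g x) = f x" "g x \<in> verts B" if "x \<in> verts A" for x
      proof -
        have "f x \<in> h ` verts B" using f'(2) that by (auto simp: strong_def)
        then show "h (g x) = f x" "g x \<in> verts B" unfolding g_def by (simp_all add: f_inv_into_f inv_into_into)
      qed
      have "strict_mono_on {..<a} \<eta>"
      proof (rule strict_mono_onI)
        fix i j assume ij: "i \<in> {..<a}" "j \<in> {..<a}" "i < j"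
        then have A: "\<alpha> i \<in> verts A" "\<alpha> j \<in> verts A" "(\<alpha> i, \<alpha> j) \<in> ord A" using \<alpha>A \<alpha>(2) by auto
        then obtain x y where xy: "(x, y) \<in> ord B" "f (\<alpha> i) = h x" "f (\<alpha> j) = h y" using f_mono by blast
        then have "x = g (\<alpha> i)" "y = g (\<alpha> j)"
          using hg A \<gamma>'_mono[OF xy(1)] h_inj by (metis inj_onD)+
        then have "\<eta> i \<le> \<eta> j" using \<gamma>'_mono[OF xy(1)] by (simp add: \<eta>_def)
        moreover have "\<eta> i \<noteq> \<eta> j" using strong_\<eta> ij unfolding strong_def by (metis inj_onD less_irrefl)
        ultimately show "\<eta> i < \<eta> j" by simp
      qed
      then have col: "\<chi> (\<beta> ` \<eta> ` {..<a}) = c" using mono[OF strong_\<eta>] by blast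
      have "\<iota> ` \<beta> ` \<eta> ` {..<a} = h ` g ` \<alpha> ` {..<a}" by (simp add: \<eta>_def h_def image_image)
      also have "\<dots> = f ` verts A" using \<alpha>(1) hg(1) by (simp add: bij_betw_def image_image)
      finally have verts_eq: "\<iota> ` \<beta> ` \<eta> ` {..<a} = f ` verts A" .
      have "good (\<beta> ` \<eta> ` {..<a}) i"
        unfolding good_def verts_eq using i f(2) by (auto simp: steiner_image_def intro!: bexI[of _ A1])
      \<comment> \<open>The colour \<open>c\<close> only says that \<open>P c\<close> contains some
        copy on these vertices; by \<open>mono_inj_unique\<close> that copy is
        \<open>A1\<close>.\<close>
      from good[OF this] obtain A2 where A2: "c < r" "A2 \<in> P c" "verts A2 = f ` verts A"
        unfolding good_def col verts_eq by blast
      then have "A2 \<in> copies (strong_embedding k t) steiner_image C A" using P by blast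
      then obtain f2 where f2: "strong_embedding k t f2 A C" "A2 = steiner_image f2 A" by (auto simp: copies_def)
      have f2_C: "mono_inj f2 A C" using f2(1) by (simp add: strong_embedding_def)
      have im: "f2 ` verts A = f ` verts A" using A2(3) f2(2) by (simp add: steiner_image_def)
      have eq: "f2 x = f x" if "x \<in> verts A" for x
        by (rule mono_inj_unique[OF linA stA(1) linC f2_C f_C im that])
      have "(`) f2 ` edges A = (`) f ` edges A" using eq stA(2) by (intro image_cong refl) blast
      moreover have "map_prod f2 f2 ` ord A = map_prod f f ` ord A"
        using eq linear_orderD(1)[OF linA] by (intro image_cong refl) (auto simp: map_prod_def)
      ultimately have "A2 = A1" using im f(2) f2(2) by (simp add: steiner_image_def)
      then show ?thesis using A2 by simp
    qed
    \<comment> \<open>\<open>in_P\<close> gives \<open>c < r\<close> only in the presence of a copy;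
      without one any class serves.\<close>
    have "\<exists>i<r. copies (strong_embedding k t) steiner_image B1 A \<subseteq> P i"
      using in_P r by (cases "copies (strong_embedding k t) steiner_image B1 A = {}") blast+
    then show "\<exists>B'\<in>copies (strong_embedding k t) steiner_image C B. \<exists>i<r. copies (strong_embedding k t) steiner_image B' A \<subseteq> P i"
      using B1 by blast
  qed
qed

section \<open>Structures with a partial function\<close>

text \<open>\<open>\<Phi>\<close> carries the copies in a structure onto the copies in its image.
  Its injectivity keeps the classes of a partition disjoint and allows containment in a class to be
  pulled back.\<close>

lemma ramsey_class_transfer:
  assumes bij: "bij_betw \<Phi> \<C> \<D>"
    and emb: "\<And>f A B. A \<in> \<C> \<Longrightarrow> B \<in> \<C> \<Longrightarrow> emb f A B \<longleftrightarrow> emb' f (\<Phi> A) (\<Phi> B)"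
    and img: "\<And>f A B. A \<in> \<C> \<Longrightarrow> B \<in> \<C> \<Longrightarrow> emb f A B \<Longrightarrow> img f A \<in> \<C> \<and> \<Phi> (img f A) = img' f (\<Phi> A)"
    and ramsey: "ramsey_class \<D> emb' img'"
  shows "ramsey_class \<C> emb img"
  unfolding ramsey_class_def
proof (intro ballI allI impI)
  fix A B and r :: nat assume A: "A \<in> \<C>" and B: "B \<in> \<C>" and r: "r > 0"
  have inj: "inj_on \<Phi> \<C>" and im: "\<Phi> ` \<C> = \<D>" using bij by (auto simp: bij_betw_def)
  have copies: "copies emb' img' (\<Phi> D) (\<Phi> A) = \<Phi> ` copies emb img D A"
    if D: "D \<in> \<C>" for D
  proof (intro equalityI subsetI)
    fix X assume "X \<in> copies emb' img' (\<Phi> D) (\<Phi> A)"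
    then obtain f where f: "emb f A D" "X = img' f (\<Phi> A)" using emb[OF A D] unfolding copies_def by blast
    then have "X = \<Phi> (img f A)" using img[OF A D f(1)] by simp
    then show "X \<in> \<Phi> ` copies emb img D A" using f(1) unfolding copies_def by blast
  next
    fix X assume "X \<in> \<Phi> ` copies emb img D A"
    then obtain f where f: "emb f A D" "X = \<Phi> (img f A)" unfolding copies_def by blast
    then show "X \<in> copies emb' img' (\<Phi> D) (\<Phi> A)"
      using img[OF A D f(1)] emb[OF A D] unfolding copies_def by auto
  qed
  have copies_sub: "copies emb img D A \<subseteq> \<C>" if "D \<in> \<C>" for D
    using img[OF A that] unfolding copies_def by blast
  have "\<Phi> A \<in> \<D>" "\<Phi> B \<in> \<D>" using A B im by auto
  then obtain C' where C': "C' \<in> \<D>"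
    and ram: "\<And>Q. disjoint_family_on Q {..<r} \<Longrightarrow> (\<Union>i<r. Q i) = copies emb' img' C' (\<Phi> A) \<Longrightarrow>
      \<exists>B'\<in>copies emb' img' C' (\<Phi> B). \<exists>i<r. copies emb' img' B' (\<Phi> A) \<subseteq> Q i"
    using ramsey r unfolding ramsey_class_def by metis
  then obtain C where C: "C \<in> \<C>" "C' = \<Phi> C" using im by blast
  show "\<exists>C\<in>\<C>. \<forall>P. disjoint_family_on P {..<r} \<and> (\<Union>i<r. P i) = copies emb img C A \<longrightarrow>
      (\<exists>B'\<in>copies emb img C B. \<exists>i<r. copies emb img B' A \<subseteq> P i)"
  proof (intro bexI[OF _ C(1)] allI impI, elim conjE)
    fix P :: "nat \<Rightarrow> _ set"
    assume disj: "disjoint_family_on P {..<r}" and P: "(\<Union>i<r. P i) = copies emb img C A"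
    have PC: "P i \<subseteq> \<C>" if "i < r" for i using that P copies_sub[OF C(1)] by blast
    have "disjoint_family_on (\<lambda>i. \<Phi> ` P i) {..<r}"
      unfolding disjoint_family_on_def
    proof (intro ballI impI)
      fix i j assume ij: "i \<in> {..<r}" "j \<in> {..<r}" "i \<noteq> j"
      then have "P i \<inter> P j = {}" using disj unfolding disjoint_family_on_def by blast
      moreover have "\<Phi> ` P i \<inter> \<Phi> ` P j = \<Phi> ` (P i \<inter> P j)"
        using inj_on_image_Int[OF inj] PC ij by (metis lessThan_iff)
      ultimately show "\<Phi> ` P i \<inter> \<Phi> ` P j = {}" by simp
    qed
    moreover have "(\<Union>i<r. \<Phi> ` P i) = copies emb' img' C' (\<Phi> A)"
      using copies[OF C(1)] C(2) P by (simp add: image_UN[symmetric])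
    ultimately obtain B' i where B': "B' \<in> copies emb' img' C' (\<Phi> B)" and i: "i < r"
      and sub: "copies emb' img' B' (\<Phi> A) \<subseteq> \<Phi> ` P i"
      using ram by blast
    obtain h where h: "emb' h (\<Phi> B) (\<Phi> C)" "B' = img' h (\<Phi> B)" using B' C(2) by (auto simp: copies_def)
    then have h': "emb h B C" using emb[OF B C(1)] by simp
    then have B1: "img h B \<in> \<C>" "\<Phi> (img h B) = B'" using img[OF B C(1)] h(2) by auto
    have "copies emb img (img h B) A \<subseteq> P i"
    proof
      fix X assume X: "X \<in> copies emb img (img h B) A"
      then have "\<Phi> X \<in> \<Phi> ` P i" using copies[OF B1(1)] B1(2) sub by blast
      then show "X \<in> P i" using inj X copies_sub[OF B1(1)] PC[OF i] by (metis imageE inj_onD subsetD)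
    qed
    then show "\<exists>B'\<in>copies emb img C B. \<exists>i<r. copies emb img B' A \<subseteq> P i"
      using i h' unfolding copies_def by blast
  qed
qed

section \<open>Edges as values of the partial function\<close>

definition hypergraph_of :: "'v func_struct \<Rightarrow> 'v ord_hypergraph" where
  "hypergraph_of A = \<lparr>verts = verts A, ord = ord A, edges = ran (func A)\<rparr>"

lemma hypergraph_of_simps [simp]:
  "verts (hypergraph_of A) = verts A" "ord (hypergraph_of A) = ord A" "edges (hypergraph_of A) = ran (func A)"
  by (simp_all add: hypergraph_of_def)

lemma class_KD:
  assumes "A \<in> class_K k t"
  shows "finite (verts A)" "linear_order_on (verts A) (ord A)"
    "dom (func A) \<subseteq> {ts. length ts = t \<and> set ts \<subseteq> verts A}" "ran (func A) \<subseteq> [verts A]\<^bsup>k\<^esup>"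
    "\<forall>ts\<in>dom (func A). distinct ts"
    "\<forall>ts\<in>dom (func A). set ts \<subseteq> the (func A ts) \<and>
      (\<forall>ts2. length ts2 = t \<and> distinct ts2 \<and> set ts2 \<subseteq> the (func A ts) \<longrightarrow>
         ts2 \<in> dom (func A) \<and> the (func A ts2) = the (func A ts))"
  using assms unfolding class_K_def mem_Collect_eq by - (elim conjE, assumption)+

text \<open>The closure condition on tuples makes the partial function recoverable from its range,
  so passing to the hypergraph loses nothing.\<close>

lemma class_K_func_iff:
  assumes "A \<in> class_K k t"
  shows "func A xs = Some e \<longleftrightarrow> e \<in> ran (func A) \<and> length xs = t \<and> distinct xs \<and> set xs \<subseteq> e"
proof
  assume e: "func A xs = Some e"
  then have dom: "xs \<in> dom (func A)" by blast
  have "e \<in> ran (func A)" using e by (rule ranI)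
  moreover have "length xs = t" using class_KD(3)[OF assms] dom by blast
  moreover have "distinct xs" using class_KD(5)[OF assms] dom by blast
  moreover have "set xs \<subseteq> e" using bspec[OF class_KD(6)[OF assms] dom] e by simp
  ultimately show "e \<in> ran (func A) \<and> length xs = t \<and> distinct xs \<and> set xs \<subseteq> e" by blast
next
  assume e: "e \<in> ran (func A) \<and> length xs = t \<and> distinct xs \<and> set xs \<subseteq> e"
  then obtain ts where ts: "func A ts = Some e" unfolding ran_def by blast
  then have "ts \<in> dom (func A)" by blast
  from bspec[OF class_KD(6)[OF assms] this]
  have "xs \<in> dom (func A) \<and> the (func A xs) = e" using ts e by simp
  then show "func A xs = Some e" by auto
qed

lemma subset_list:
  assumes "finite e" "t \<le> card e"
  obtains xs where "length xs = t" "distinct xs" "set xs \<subseteq> e"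
proof -
  obtain s where s: "s \<subseteq> e" "card s = t" "finite s" using obtain_subset_with_card_n[OF assms(2)] by blast
  obtain xs where "set xs = s" "distinct xs" using finite_distinct_list[OF s(3)] by blast
  then show ?thesis using that[of xs] distinct_card[of xs] s by simp
qed

lemma hypergraph_of_in_systems:
  assumes A: "A \<in> class_K k t"
  shows "hypergraph_of A \<in> steiner_systems k t"
  unfolding steiner_systems_def
proof (intro CollectI conjI ballI impI)
  fix s e e' assume s: "s \<in> [verts (hypergraph_of A)]\<^bsup>t\<^esup>"
    and e: "e \<in> edges (hypergraph_of A)" "e' \<in> edges (hypergraph_of A)" "s \<subseteq> e \<and> s \<subseteq> e'"
  obtain xs where "length xs = t" "distinct xs" "set xs \<subseteq> s"
    using s subset_list[of s t] by (auto simp: nsets_def)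
  then have "func A xs = Some e" "func A xs = Some e'"
    using class_K_func_iff[OF A] e by auto
  then show "e = e'" by simp
qed (use class_KD(1,2,4)[OF A] in simp_all)

text \<open>The Steiner condition makes the edge around a tuple unique, and \<open>t \<le> k\<close>
  provides a tuple inside every edge, so that each edge is a value.\<close>

lemma func_of_system:
  assumes G: "G \<in> steiner_systems k t" and kt: "t \<le> k"
  obtains A where "A \<in> class_K k t" "hypergraph_of A = G"
proof -
  let ?E = "\<lambda>xs e. e \<in> edges G \<and> length xs = t \<and> distinct xs \<and> set xs \<subseteq> e"
  define F where "F xs = (if \<exists>e. ?E xs e then Some (SOME e. ?E xs e) else None)" for xs
  have E: "edges G \<subseteq> [verts G]\<^bsup>k\<^esup>" using G by (simp add: steiner_systems_def)
  have unique: "e = e'" if e: "?E xs e" "?E xs e'" for xs e e'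
  proof -
    have "set xs \<in> [verts G]\<^bsup>t\<^esup>" using e E by (auto simp: nsets_def distinct_card)
    then show ?thesis using G e unfolding steiner_systems_def by blast
  qed
  have F: "F xs = Some e \<longleftrightarrow> ?E xs e" for xs e
  proof
    assume F: "F xs = Some e"
    then have "\<exists>e. ?E xs e" unfolding F_def by (metis option.distinct(1))
    moreover have "e = (SOME e. ?E xs e)" using F unfolding F_def by (metis option.distinct(1) option.inject)
    ultimately show "?E xs e" using someI_ex[of "?E xs"] by metis
  next
    assume e: "?E xs e"
    then have "?E xs (SOME e. ?E xs e)" by (rule someI)
    then have "(SOME e. ?E xs e) = e" using e by (rule unique)
    then show "F xs = Some e" unfolding F_def using e by auto
  qed
  have ran: "ran F = edges G"
  proof
    show "ran F \<subseteq> edges G" using F by (auto simp: ran_def)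
    show "edges G \<subseteq> ran F"
    proof
      fix e assume e: "e \<in> edges G"
      then have "finite e" "t \<le> card e" using E kt by (auto simp: nsets_def)
      then obtain xs where "length xs = t" "distinct xs" "set xs \<subseteq> e" by (rule subset_list)
      then have "F xs = Some e" using F e by blast
      then show "e \<in> ran F" by (rule ranI)
    qed
  qed
  let ?A = "\<lparr>verts = verts G, ord = ord G, func = F\<rparr>"
  have "?A \<in> class_K k t"
    unfolding class_K_def
  proof (intro CollectI conjI ballI allI impI; simp?)
    show "finite (verts G)" "linear_order_on (verts G) (ord G)" using G by (simp_all add: steiner_systems_def)
    have "e \<subseteq> verts G" if "e \<in> edges G" for e using E that by (auto simp: nsets_def)
    then show "dom F \<subseteq> {ts. length ts = t \<and> set ts \<subseteq> verts G}" using F unfolding dom_def by blast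
    show "ran F \<subseteq> [verts G]\<^bsup>k\<^esup>" using E ran by simp
    fix ts assume "ts \<in> dom F"
    then obtain e where e: "F ts = Some e" by blast
    have the: "the (F ts) = e" using e by simp
    show "distinct ts" "set ts \<subseteq> the (F ts)" using e[unfolded F] unfolding the by blast+
    fix ts2 assume "length ts2 = t \<and> distinct ts2 \<and> set ts2 \<subseteq> the (F ts)"
    then have "F ts2 = Some e" using e[unfolded F] unfolding F the by blast
    then show "ts2 \<in> dom F" "the (F ts2) = the (F ts)" using e by auto
  qed
  moreover have "hypergraph_of ?A = G" using ran by (simp add: hypergraph_of_def)
  ultimately show ?thesis using that by blast
qed

lemma hypergraph_of_inject:
  assumes "A \<in> class_K k t" "B \<in> class_K k t" "hypergraph_of A = hypergraph_of B"
  shows "A = B"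
proof -
  have "func A xs = Some e \<longleftrightarrow> func B xs = Some e" for xs e
    using class_K_func_iff assms by (metis hypergraph_of_simps(3))
  then have "func A = func B" by (intro ext) (metis not_Some_eq)
  then show ?thesis using assms(3) by (cases A; cases B) (simp add: hypergraph_of_def)
qed

text \<open>Tuples of \<open>t\<close> distinct vertices in the image are images of tuples in
  \<open>A\<close>. Reflection of the domain together with the value condition therefore says that
  an edge of \<open>B\<close> through \<open>t\<close> image vertices is the image of an edge of
  \<open>A\<close>: the strength clause, called \<open>lift\<close> in both directions.\<close>

lemma K_embedding_iff:
  assumes A: "A \<in> class_K k t" and B: "B \<in> class_K k t" and kt: "t \<le> k"
  shows "K_embedding t f A B \<longleftrightarrow> strong_embedding k t f (hypergraph_of A) (hypergraph_of B)"
proof -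
  note A_iff = class_K_func_iff[OF A] and B_iff = class_K_func_iff[OF B]
  have ranA: "ran (func A) \<subseteq> [verts A]\<^bsup>k\<^esup>" using class_KD(4)[OF A] .
  have mono: "mono_inj f (hypergraph_of A) (hypergraph_of B) \<longleftrightarrow> mono_inj f A B" by (simp add: mono_inj_def)
  show ?thesis
  proof (cases "mono_inj f A B")
    case True
    then have inj: "inj_on f (verts A)" by (simp add: mono_inj_def)
    show ?thesis
    proof
      assume K: "K_embedding t f A B"
      then have dom: "xs \<in> dom (func A) \<longleftrightarrow> map f xs \<in> dom (func B)"
        and val: "func A xs = Some e \<Longrightarrow> func B (map f xs) = Some (f ` e)"
        if "length xs = t" "set xs \<subseteq> verts A" for xs e
        using that unfolding K_embedding_def by (blast, force)
      have lift: "\<exists>e\<in>ran (func A). set xs \<subseteq> e \<and> d = f ` e"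
        if xs: "length xs = t" "distinct xs" "set xs \<subseteq> verts A" "f ` set xs \<subseteq> d" "d \<in> ran (func B)" for xs d
      proof -
        have "distinct (map f xs)" using xs inj by (simp add: distinct_map inj_on_subset)
        then have d: "func B (map f xs) = Some d" using xs by (simp add: B_iff)
        then obtain e where e: "func A xs = Some e" using dom[OF xs(1,3)] by blast
        then have "d = f ` e" using val[OF xs(1,3) e] d by simp
        then show ?thesis using e A_iff by blast
      qed
      show "strong_embedding k t f (hypergraph_of A) (hypergraph_of B)"
        unfolding strong_embedding_def mono
      proof (intro conjI True ballI impI; simp)
        fix e assume e: "e \<in> [verts A]\<^bsup>k\<^esup>"
        then have e': "finite e" "card e = k" "e \<subseteq> verts A" by (auto simp: nsets_def)
        obtain xs where xs: "length xs = t" "distinct xs" "set xs \<subseteq> e"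
          using subset_list[OF e'(1)] e'(2) kt by metis
        show "e \<in> ran (func A) \<longleftrightarrow> f ` e \<in> ran (func B)"
        proof
          assume "e \<in> ran (func A)"
          then have "func A xs = Some e" using A_iff xs by blast
          then show "f ` e \<in> ran (func B)" using val[OF xs(1)] xs(3) e'(3) by (metis ranI subset_trans)
        next
          assume "f ` e \<in> ran (func B)"
          then obtain e1 where e1: "e1 \<in> ran (func A)" "f ` e = f ` e1"
            using lift[OF xs(1,2), of "f ` e"] xs(3) e'(3) by blast
          then have "e = e1" using inj e'(3) ranA by (metis (no_types, lifting) inj_on_image_eq_iff mem_Collect_eq nsets_def subsetD)
          then show "e \<in> ran (func A)" using e1 by simp
        qed
      next
        fix s e' assume s: "s \<in> [f ` verts A]\<^bsup>t\<^esup>" and e': "e' \<in> ran (func B)" "s \<subseteq> e'"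
        then obtain u where u: "u \<subseteq> verts A" "s = f ` u" by (auto simp: nsets_def subset_image_iff)
        then have "finite u" "card u = t" using s inj
          by (auto simp: nsets_def card_image inj_on_subset finite_image_iff)
        then obtain xs where xs: "length xs = t" "distinct xs" "set xs \<subseteq> u" using subset_list[of u t] by auto
        then show "\<exists>e\<in>ran (func A). e' = f ` e"
          using lift[OF xs(1,2) _ _ e'(1)] u e'(2) by blast
      qed
    next
      assume S: "strong_embedding k t f (hypergraph_of A) (hypergraph_of B)"
      then have edges: "f ` e \<in> ran (func B)" if "e \<in> ran (func A)" for e
        using that ranA unfolding strong_embedding_def by auto
      have lift: "\<exists>e\<in>ran (func A). d = f ` e" if "s \<in> [f ` verts A]\<^bsup>t\<^esup>" "d \<in> ran (func B)" "s \<subseteq> d" for s d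
        using S that unfolding strong_embedding_def by auto
      show "K_embedding t f A B"
        unfolding K_embedding_def
      proof (intro conjI True allI impI)
        fix xs assume xs: "length xs = t \<and> set xs \<subseteq> verts A"
        have val: "func B (map f xs) = Some (f ` e)" if e: "func A xs = Some e" for e
        proof -
          have "e \<in> ran (func A)" "distinct xs" "set xs \<subseteq> e" using e A_iff by auto
          then show ?thesis
            using xs edges inj by (auto simp: B_iff distinct_map inj_on_subset)
        qed
        show "the (func B (map f xs)) = f ` the (func A xs)" if "xs \<in> dom (func A)"
          using that val by auto
        show "xs \<in> dom (func A) \<longleftrightarrow> map f xs \<in> dom (func B)"
        proof
          assume "map f xs \<in> dom (func B)"
          then obtain d where "func B (map f xs) = Some d" by blast
          then have d: "d \<in> ran (func B)" "distinct (map f xs)" "f ` set xs \<subseteq> d" using B_iff by auto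
          have "card (f ` set xs) = t" using distinct_card[OF d(2)] xs by simp
          then have "f ` set xs \<in> [f ` verts A]\<^bsup>t\<^esup>" using xs by (auto simp: nsets_def)
          then obtain e where e: "e \<in> ran (func A)" "d = f ` e" using lift d by blast
          have "e \<subseteq> verts A" using e ranA by (auto simp: nsets_def)
          then have "set xs \<subseteq> e"
            using d(3) e(2) xs inj_on_image_mem_iff[OF inj] by blast
          then show "xs \<in> dom (func A)" using A_iff e(1) xs d(2) by (auto simp: distinct_map)
        qed (use val in auto)
      qed
    qed
  qed (auto simp: K_embedding_def strong_embedding_def mono)
qed

text \<open>Instead of checking the axioms for \<open>K_image\<close>, a member \<open>A2\<close> of
  the class is taken whose hypergraph is the transported one, and its partial function is shown to
  be that of \<open>K_image\<close>.\<close>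

lemma hypergraph_of_K_image:
  assumes A: "A \<in> class_K k t" and B: "B \<in> class_K k t" and kt: "t \<le> k" and f: "K_embedding t f A B"
  shows "K_image f A \<in> class_K k t \<and> hypergraph_of (K_image f A) = steiner_image f (hypergraph_of A)"
proof -
  have inj: "inj_on f (verts A)" using f by (simp add: K_embedding_def mono_inj_def)
  note A_iff = class_K_func_iff[OF A]
  have ranA: "e \<subseteq> verts A" if "e \<in> ran (func A)" for e using class_KD(4)[OF A] that by (auto simp: nsets_def)
  have "steiner_image f (hypergraph_of A) \<in> steiner_systems k t"
    using steiner_image_in_systems[OF hypergraph_of_in_systems[OF A]] inj by simp
  then obtain A2 where A2: "A2 \<in> class_K k t" "hypergraph_of A2 = steiner_image f (hypergraph_of A)"
    using func_of_system[OF _ kt] by metis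
  have ran2: "ran (func A2) = (`) f ` ran (func A)" and verts2: "verts A2 = f ` verts A"
    and ord2: "ord A2 = map_prod f f ` ord A"
    using A2(2) by (simp_all add: steiner_image_def hypergraph_of_def)
  have "func (K_image f A) ys = Some d \<longleftrightarrow> func A2 ys = Some d" for ys d
  proof
    let ?xs = "map (inv_into (verts A) f) ys"
    have map: "map f ?xs = ys" if "set ys \<subseteq> f ` verts A"
      using that by (intro nth_equalityI) (auto simp: f_inv_into_f subset_iff)
    assume "func (K_image f A) ys = Some d"
    then obtain e where ys: "set ys \<subseteq> f ` verts A" "func A ?xs = Some e" "d = f ` e"
      by (auto simp: K_image_def split: if_splits)
    then have e: "e \<in> ran (func A)" "length ?xs = t" "distinct ?xs" "set ?xs \<subseteq> e"
      using A_iff by auto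
    have "distinct (map f ?xs)" using e ranA inj by (metis distinct_map inj_on_subset subset_trans)
    moreover have "set (map f ?xs) \<subseteq> f ` e" unfolding set_map[of f] by (rule image_mono[OF e(4)])
    ultimately have "distinct ys" "set ys \<subseteq> f ` e" unfolding map[OF ys(1)] .
    then show "func A2 ys = Some d"
      unfolding class_K_func_iff[OF A2(1)] ran2 using e(1,2) ys(3) by simp
  next
    assume "func A2 ys = Some d"
    then obtain e where e: "e \<in> ran (func A)" "d = f ` e" "length ys = t" "distinct ys" "set ys \<subseteq> f ` e"
      unfolding class_K_func_iff[OF A2(1)] ran2 by blast
    then have ys: "set ys \<subseteq> f ` verts A" using ranA by blast
    have "set (map (inv_into (verts A) f) ys) \<subseteq> e"
      using e(5) ranA[OF e(1)] inj by (auto simp: subset_iff image_iff)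
    moreover have "distinct (map (inv_into (verts A) f) ys)"
      using e(4) ys by (simp add: distinct_map inj_on_inv_into)
    ultimately have "func A (map (inv_into (verts A) f) ys) = Some e"
      using A_iff e by simp
    then show "func (K_image f A) ys = Some d" using ys e(2) by (simp add: K_image_def)
  qed
  then have "func (K_image f A) = func A2" by (intro ext) (metis not_Some_eq)
  then have "K_image f A = A2" using verts2 ord2 by (cases A2) (simp add: K_image_def)
  then show ?thesis using A2 by simp
qed

theorem theorem5p1:
  fixes k t :: nat
  assumes "infinite (UNIV :: 'v set)"
    and "t \<ge> 2" and "k > t"
  shows "ramsey_class (class_K k t :: 'v func_struct set) (K_embedding t) K_image \<and>
         ramsey_class (steiner_systems k t :: 'v ord_hypergraph set) (strong_embedding k t) steiner_image"
proof
  have kt: "t \<le> k" and t: "t > 0" using assms(2,3) by auto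
  show steiner: "ramsey_class (steiner_systems k t :: 'v ord_hypergraph set) (strong_embedding k t) steiner_image"
    using steiner_systems_ramsey[OF assms(1) t kt] .
  \<comment> \<open>The logical order is the reverse of the statement: the result on systems comes
    first and is transferred along \<open>hypergraph_of\<close>, under which the same vertex maps
    are embeddings.\<close>
  show "ramsey_class (class_K k t :: 'v func_struct set) (K_embedding t) K_image"
  proof (rule ramsey_class_transfer[OF _ _ _ steiner])
    show "bij_betw hypergraph_of (class_K k t :: 'v func_struct set) (steiner_systems k t)"
      unfolding bij_betw_def
    proof
      show "inj_on hypergraph_of (class_K k t :: 'v func_struct set)"
        by (rule inj_onI) (rule hypergraph_of_inject)
      show "hypergraph_of ` class_K k t = (steiner_systems k t :: 'v ord_hypergraph set)"
      proof (intro equalityI subsetI)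
        fix G :: "'v ord_hypergraph" assume "G \<in> steiner_systems k t"
        then obtain A where "A \<in> class_K k t" "hypergraph_of A = G" using kt by (rule func_of_system)
        then show "G \<in> hypergraph_of ` class_K k t" by blast
      qed (use hypergraph_of_in_systems in blast)
    qed
  qed (use K_embedding_iff hypergraph_of_K_image kt in blast)+
qed

end
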